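(* In IITT, if $\Gamma\vdash(x\star U)\to^{s_1,s_2}T=(x\star U')\to^{s_1',s_2'}T':s_3$, then $s_1=s_1'$, $s_2=s_2'$, $\Gamma\vdash U=U':s_1$, and $\Gamma.x\star U\vdash T=T':s_2$.
   Context: Irrelevant Intensional Type Theory (IITT) is defined as follows. Sorts are $\mathsf{Set}_k$ ($k\in\mathbb{N}$), with $\mathsf{Axiom}=\{(\mathsf{Set}_i,\mathsf{Set}_{i+1})\mid i\in\mathbb{N}\}$ and $\mathsf{Rule}=\{(\mathsf{Set}_i,\mathsf{Set}_j,\mathsf{Set}_{\max(i,j)})\mid i,j\in\mathbb{N}\}$. Annotations are $\star\in\{:,\div\}$ (relevant, irrelevant). Expressions: $t,u,T,U ::= s \mid (x\star U)\to^{s,s'}T \mid x \mid \lambda x\star U.\,t \mid t\star u$, where $(x\star U)\to^{s,s'}T$ is a relevant or irrelevant dependent function type annotated with the sort $s$ of its domain and $s'$ of its codomain, and $t\star u$ is relevant application (also written $t\,u$) or irrelevant application $t\div u$. Expressions are taken modulo $\alpha$-equivalence; $[u/x]t$ is capture-avoiding substitution. Contexts: $\Gamma ::= () \mid \Gamma.\,x\star T$ (variables distinct). Resurrection $\Gamma^{\oplus}$ replaces each binding $x\div T$ by $x:T$. Abbreviations: $\Gamma\vdash t\div T$ means $\Gamma^\oplus\vdash t:T$; $\Gamma\vdash t=t'\div T$ means $\Gamma\vdash t\div T$ and $\Gamma\vdash t'\div T$; $\Gamma\vdash T$ means $\Gamma\vdash T:s$ for some sort $s$; $\Gamma\vdash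 T=T'$ means $\Gamma\vdash T=T':s$ for some $s$. The judgements $\vdash\Gamma$, $\Gamma\vdash t:T$, $\Gamma\vdash t=t':T$ are defined mutually inductively by: (contexts) $\vdash()$; from $\vdash\Gamma$ and $\Gamma\vdash T$ infer $\vdash\Gamma.x\star T$. (typing) from $\vdash\Gamma$, $(s,s')\in\mathsf{Axiom}$ infer $\Gamma\vdash s:s'$; from $\Gamma\vdash U:s_1$, $\Gamma.x\star U\vdash T:s_2$, $(s_1,s_2,s_3)\in\mathsf{Rule}$ infer $\Gamma\vdash (x\star U)\to^{s_1,s_2}T:s_3$; from $\vdash\Gamma$ and $(x:U)\in\Gamma$ infer $\Gamma\vdash x:U$ (no variable rule for irrelevant bindings); from $\Gamma.x\star U\vdash t:T$ and $\Gamma\vdash (x\star U)\to^{s,s'}T$ infer $\Gamma\vdash \lambda x\star U.t:(x\star U)\to^{s,s'}T$; from $\Gamma\vdash t:(x\star U)\to^{s,s'}T$ and $\Gamma\vdash u\star U$ infer $\Gamma\vdash t\star u:[u/x]T$; from $\Gamma\vdash t:T$ and $\Gamma\vdash T=T'$ infer $\Gamma\vdash t:T'$. (equality) $\beta$: from $\Gamma.x\star U\vdash t:T$ and $\Gamma\vdash u\star U$ infer $\Gamma\vdash(\lambda x\star U.t)\star u=[u/x]t:[u/x]T$; $\eta$: from $\Gamma\vdash t:(x\star U)\to^{s,s'}T$ infer $\Gamma\vdash t=\lambda x\star U.(t\star x):(x\star U)\to^{s,s'}T$; reflexivity, symmetry, transitivity; from $\Gamma\vdash U=U':s_1$, $\Gamma.x\star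 U\vdash T=T':s_2$, $(s_1,s_2,s_3)\in\mathsf{Rule}$ infer $\Gamma\vdash (x\star U)\to^{s_1,s_2}T=(x\star U')\to^{s_1,s_2}T':s_3$; from $\Gamma\vdash U=U':s_1$, $\Gamma.x\star U\vdash T:s_2$, $\Gamma.x\star U\vdash t=t':T$ infer $\Gamma\vdash\lambda x\star U.t=\lambda x\star U'.t':(x\star U)\to^{s_1,s_2}T$; from $\Gamma\vdash t=t':(x\star U)\to^{s,s'}T$ and $\Gamma\vdash u=u'\star U$ infer $\Gamma\vdash t\star u=t'\star u':[u/x]T$; from $\Gamma\vdash t=t':T$ and $\Gamma\vdash T=T'$ infer $\Gamma\vdash t=t':T'$. *)

theory Defs
  imports Main
begin

datatype srt = Set nat

definition Axiom :: "(srt \<times> srt) set" where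
  "Axiom = {(Set i, Set (Suc i)) | i. True}"

definition Rule :: "(srt \<times> srt \<times> srt) set" where
  "Rule = {(Set i, Set j, Set (max i j)) | i j. True}"

datatype annot = Rel | Irr

text \<open>Expressions modulo alpha-equivalence are represented with de Bruijn indices:
  the second expression argument of \<open>Fun\<close> and of \<open>Lam\<close> is in the scope of one more variable,
  whose index is 0.
  The sorts \<open>s\<close>, \<open>s'\<close> in \<open>Fun a s s' U T\<close> annotate domain and codomain.\<close>

datatype tm =
    Sort srt
  | Fun annot srt srt tm tm
  | Var nat
  | Lam annot tm tm
  | App annot tm tm

text \<open>\<open>lift k t\<close> makes room for one new variable with index \<open>k\<close>.\<close>

primrec lift :: "nat \<Rightarrow> tm \<Rightarrow> tm" where
  "lift k (Sort s) = Sort s"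
| "lift k (Fun a s s' U T) = Fun a s s' (lift k U) (lift (Suc k) T)"
| "lift k (Var i) = Var (if i < k then i else Suc i)"
| "lift k (Lam a U t) = Lam a (lift k U) (lift (Suc k) t)"
| "lift k (App a t u) = App a (lift k t) (lift k u)"

text \<open>\<open>subst k u t\<close> replaces variable \<open>k\<close> by \<open>u\<close> in \<open>t\<close> and removes that variable from the scope,
  so \<open>[u/x]t\<close> for the innermost variable \<open>x\<close> is \<open>subst 0 u t\<close>.\<close>

primrec subst :: "nat \<Rightarrow> tm \<Rightarrow> tm \<Rightarrow> tm" where
  "subst k u (Sort s) = Sort s"
| "subst k u (Fun a s s' U T) = Fun a s s' (subst k u U) (subst (Suc k) (lift 0 u) T)"
| "subst k u (Var i) = (if i < k then Var i else if i = k then u else Var (i - 1))"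
| "subst k u (Lam a U t) = Lam a (subst k u U) (subst (Suc k) (lift 0 u) t)"
| "subst k u (App a t v) = App a (subst k u t) (subst k u v)"

text \<open>The head of the list is the innermost binding, so the extension of \<open>\<Gamma>\<close> by a binding of type
  \<open>U\<close> with annotation \<open>a\<close> is \<open>(a, U) # \<Gamma>\<close>; each type lives in the scope of the bindings
  after it in the list.\<close>

type_synonym ctx = "(annot \<times> tm) list"

definition resurrect :: "ctx \<Rightarrow> ctx" where
  "resurrect \<Gamma> = map (\<lambda>(a, T). (Rel, T)) \<Gamma>"

text \<open>The judgement that \<open>u\<close> has type \<open>U\<close> with annotation \<open>a\<close> in \<open>\<Gamma>\<close> is
  \<open>ctx_for a \<Gamma> \<turnstile> u \<^bold>: U\<close>.\<close>

primrec ctx_for :: "annot \<Rightarrow> ctx \<Rightarrow> ctx" where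
  "ctx_for Rel \<Gamma> = \<Gamma>"
| "ctx_for Irr \<Gamma> = resurrect \<Gamma>"

text \<open>Premises that only require some sort (\<open>\<Gamma> \<turnstile> T\<close> or \<open>\<Gamma> \<turnstile> T = T'\<close>) appear below
  with a sort variable that does not occur in the conclusion. The congruence rule for
  application is split by annotation: irrelevant arguments only have to be well-typed in the
  resurrected context.\<close>

inductive
  wf_ctx :: "ctx \<Rightarrow> bool" ("\<turnstile> _" [51] 50) and
  typing :: "ctx \<Rightarrow> tm \<Rightarrow> tm \<Rightarrow> bool" ("_ \<turnstile> _ \<^bold>: _" [51, 51, 51] 50) and
  equality :: "ctx \<Rightarrow> tm \<Rightarrow> tm \<Rightarrow> tm \<Rightarrow> bool" ("_ \<turnstile> _ \<^bold>= _ \<^bold>: _" [51, 51, 51, 51] 50)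
where
  wf_empty: "\<turnstile> []"
| wf_ext: "\<lbrakk>\<turnstile> \<Gamma>; \<Gamma> \<turnstile> T \<^bold>: Sort s\<rbrakk> \<Longrightarrow> \<turnstile> (a, T) # \<Gamma>"

| ty_sort: "\<lbrakk>\<turnstile> \<Gamma>; (s, s') \<in> Axiom\<rbrakk> \<Longrightarrow> \<Gamma> \<turnstile> Sort s \<^bold>: Sort s'"
| ty_pi: "\<lbrakk>\<Gamma> \<turnstile> U \<^bold>: Sort s1; (a, U) # \<Gamma> \<turnstile> T \<^bold>: Sort s2; (s1, s2, s3) \<in> Rule\<rbrakk>
    \<Longrightarrow> \<Gamma> \<turnstile> Fun a s1 s2 U T \<^bold>: Sort s3"
| ty_var: "\<lbrakk>\<turnstile> \<Gamma>; i < length \<Gamma>; \<Gamma> ! i = (Rel, U)\<rbrakk> \<Longrightarrow> \<Gamma> \<turnstile> Var i \<^bold>: (lift 0 ^^ Suc i) U"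
| ty_lam: "\<lbrakk>(a, U) # \<Gamma> \<turnstile> t \<^bold>: T; \<Gamma> \<turnstile> Fun a s s' U T \<^bold>: Sort s''\<rbrakk>
    \<Longrightarrow> \<Gamma> \<turnstile> Lam a U t \<^bold>: Fun a s s' U T"
| ty_app: "\<lbrakk>\<Gamma> \<turnstile> t \<^bold>: Fun a s s' U T; ctx_for a \<Gamma> \<turnstile> u \<^bold>: U\<rbrakk>
    \<Longrightarrow> \<Gamma> \<turnstile> App a t u \<^bold>: subst 0 u T"
| ty_conv: "\<lbrakk>\<Gamma> \<turnstile> t \<^bold>: T; \<Gamma> \<turnstile> T \<^bold>= T' \<^bold>: Sort s\<rbrakk> \<Longrightarrow> \<Gamma> \<turnstile> t \<^bold>: T'"

| eq_beta: "\<lbrakk>(a, U) # \<Gamma> \<turnstile> t \<^bold>: T; ctx_for a \<Gamma> \<turnstile> u \<^bold>: U\<rbrakk>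
    \<Longrightarrow> \<Gamma> \<turnstile> App a (Lam a U t) u \<^bold>= subst 0 u t \<^bold>: subst 0 u T"
| eq_eta: "\<Gamma> \<turnstile> t \<^bold>: Fun a s s' U T
    \<Longrightarrow> \<Gamma> \<turnstile> t \<^bold>= Lam a U (App a (lift 0 t) (Var 0)) \<^bold>: Fun a s s' U T"
| eq_refl: "\<Gamma> \<turnstile> t \<^bold>: T \<Longrightarrow> \<Gamma> \<turnstile> t \<^bold>= t \<^bold>: T"
| eq_sym: "\<Gamma> \<turnstile> t \<^bold>= t' \<^bold>: T \<Longrightarrow> \<Gamma> \<turnstile> t' \<^bold>= t \<^bold>: T"
| eq_trans: "\<lbrakk>\<Gamma> \<turnstile> t \<^bold>= t' \<^bold>: T; \<Gamma> \<turnstile> t' \<^bold>= t'' \<^bold>: T\<rbrakk> \<Longrightarrow> \<Gamma> \<turnstile> t \<^bold>= t'' \<^bold>: T"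
| eq_pi: "\<lbrakk>\<Gamma> \<turnstile> U \<^bold>= U' \<^bold>: Sort s1; (a, U) # \<Gamma> \<turnstile> T \<^bold>= T' \<^bold>: Sort s2; (s1, s2, s3) \<in> Rule\<rbrakk>
    \<Longrightarrow> \<Gamma> \<turnstile> Fun a s1 s2 U T \<^bold>= Fun a s1 s2 U' T' \<^bold>: Sort s3"
| eq_lam: "\<lbrakk>\<Gamma> \<turnstile> U \<^bold>= U' \<^bold>: Sort s1; (a, U) # \<Gamma> \<turnstile> T \<^bold>: Sort s2; (a, U) # \<Gamma> \<turnstile> t \<^bold>= t' \<^bold>: T\<rbrakk>
    \<Longrightarrow> \<Gamma> \<turnstile> Lam a U t \<^bold>= Lam a U' t' \<^bold>: Fun a s1 s2 U T"
| eq_app_rel: "\<lbrakk>\<Gamma> \<turnstile> t \<^bold>= t' \<^bold>: Fun Rel s s' U T; \<Gamma> \<turnstile> u \<^bold>= u' \<^bold>: U\<rbrakk>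
    \<Longrightarrow> \<Gamma> \<turnstile> App Rel t u \<^bold>= App Rel t' u' \<^bold>: subst 0 u T"
| eq_app_irr: "\<lbrakk>\<Gamma> \<turnstile> t \<^bold>= t' \<^bold>: Fun Irr s s' U T; ctx_for Irr \<Gamma> \<turnstile> u \<^bold>: U; ctx_for Irr \<Gamma> \<turnstile> u' \<^bold>: U\<rbrakk>
    \<Longrightarrow> \<Gamma> \<turnstile> App Irr t u \<^bold>= App Irr t' u' \<^bold>: subst 0 u T"
| eq_conv: "\<lbrakk>\<Gamma> \<turnstile> t \<^bold>= t' \<^bold>: T; \<Gamma> \<turnstile> T \<^bold>= T' \<^bold>: Sort s\<rbrakk> \<Longrightarrow> \<Gamma> \<turnstile> t \<^bold>= t' \<^bold>: T'"

end

theory Submission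
  imports Defs
begin

text \<open>The proof evaluates all judgements in a logical relation over terms in one fixed context
  \<open>G\<close>. A type is semantically valid if it weak-head reduces to a sort, a neutral term or a function
  type with valid components; two function types are related only if their sort annotations agree
  and their domains and codomains are judgementally equal, so injectivity can be read off from the
  fundamental theorem at the identity substitution. Because those judgemental equalities are part
  of the relation, nothing has to be read back from under a binder, and no Kripke quantification
  over extensions of \<open>G\<close> is needed: below a binder, functionality of substitution supplies the
  equality. Irrelevant arguments are never evaluated, so they only need to be well-typed in the
  resurrected context.\<close>

section \<open>Parallel substitution\<close>

text \<open>Induction on the given equation breaks at transitivity, where the middle term need not
  be a function type at all, only equal to one. Confluence is no way out: on raw lambdas with domain
  annotations beta and eta are not confluent. For this reason \<open>whn\<close> pairs every
  reduction of a type with a judgemental equation to the reduct, and head expansion takes such an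
  equation as a separate premise. A type and the relation on its terms would naturally be defined by
  induction-recursion. Here \<open>LR\<close> is the graph of that definition, an inductive
  predicate that carries the term relation as an argument, and the uniqueness lemmas
  \<open>LR_functional_left\<close> and \<open>LR_functional_right\<close> restore its functional
  reading.\<close>

definition upr :: "(nat \<Rightarrow> nat) \<Rightarrow> nat \<Rightarrow> nat" where
  "upr \<xi> i = (case i of 0 \<Rightarrow> 0 | Suc j \<Rightarrow> Suc (\<xi> j))"

primrec ren :: "(nat \<Rightarrow> nat) \<Rightarrow> tm \<Rightarrow> tm" where
  "ren \<xi> (Sort s) = Sort s"
| "ren \<xi> (Fun a s s' U T) = Fun a s s' (ren \<xi> U) (ren (upr \<xi>) T)"
| "ren \<xi> (Var i) = Var (\<xi> i)"
| "ren \<xi> (Lam a U t) = Lam a (ren \<xi> U) (ren (upr \<xi>) t)"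
| "ren \<xi> (App a t u) = App a (ren \<xi> t) (ren \<xi> u)"

definition scons :: "tm \<Rightarrow> (nat \<Rightarrow> tm) \<Rightarrow> nat \<Rightarrow> tm" (infixr "\<cdot>" 65) where
  "(u \<cdot> \<sigma>) i = (case i of 0 \<Rightarrow> u | Suc j \<Rightarrow> \<sigma> j)"

definition up :: "(nat \<Rightarrow> tm) \<Rightarrow> nat \<Rightarrow> tm" where
  "up \<sigma> = Var 0 \<cdot> (\<lambda>j. lift 0 (\<sigma> j))"

primrec sb :: "(nat \<Rightarrow> tm) \<Rightarrow> tm \<Rightarrow> tm" where
  "sb \<sigma> (Sort s) = Sort s"
| "sb \<sigma> (Fun a s s' U T) = Fun a s s' (sb \<sigma> U) (sb (up \<sigma>) T)"
| "sb \<sigma> (Var i) = \<sigma> i"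
| "sb \<sigma> (Lam a U t) = Lam a (sb \<sigma> U) (sb (up \<sigma>) t)"
| "sb \<sigma> (App a t u) = App a (sb \<sigma> t) (sb \<sigma> u)"

lemma scons_0 [simp]: "(u \<cdot> \<sigma>) 0 = u" and scons_Suc [simp]: "(u \<cdot> \<sigma>) (Suc i) = \<sigma> i"
  by (simp_all add: scons_def)

lemma upr_0 [simp]: "upr \<xi> 0 = 0" and upr_Suc [simp]: "upr \<xi> (Suc i) = Suc (\<xi> i)"
  by (simp_all add: upr_def)

lemma up_0 [simp]: "up \<sigma> 0 = Var 0" and up_Suc [simp]: "up \<sigma> (Suc i) = lift 0 (\<sigma> i)"
  by (simp_all add: up_def)

text \<open>The index-parametrised operations become instances of parallel ones, whose composition
  laws have no side conditions on indices.\<close>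

lemma lift_ren: "lift k t = ren (\<lambda>i. if i < k then i else Suc i) t"
proof (induction t arbitrary: k)
  have eq: "upr (\<lambda>i. if i < k then i else Suc i) = (\<lambda>i. if i < Suc k then i else Suc i)" for k
    by (rule ext) (auto simp: upr_def split: nat.split)
  { case Fun then show ?case by (simp add: eq) }
  { case Lam then show ?case by (simp add: eq) }
qed simp_all

lemma lift0_ren: "lift 0 t = ren Suc t"
  by (simp add: lift_ren)

lemma subst_sb: "subst k u t = sb (\<lambda>i. if i < k then Var i else if i = k then u else Var (i - 1)) t"
proof (induction t arbitrary: k u)
  have eq: "up (\<lambda>i. if i < k then Var i else if i = k then u else Var (i - 1)) =
      (\<lambda>i. if i < Suc k then Var i else if i = Suc k then lift 0 u else Var (i - 1))" for k u
    by (rule ext) (auto simp: up_def scons_def split: nat.split)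
  { case Fun then show ?case by (simp add: eq) }
  { case Lam then show ?case by (simp add: eq) }
qed simp_all

lemma subst0_sb: "subst 0 u t = sb (u \<cdot> Var) t"
proof -
  have "(\<lambda>i. if i < 0 then Var i else if i = 0 then u else Var (i - 1)) = u \<cdot> Var"
    by (rule ext) (auto simp: scons_def split: nat.split)
  then show ?thesis by (simp add: subst_sb)
qed

lemma ren_ren: "ren \<xi> (ren \<zeta> t) = ren (\<lambda>i. \<xi> (\<zeta> i)) t"
proof (induction t arbitrary: \<xi> \<zeta>)
  have eq: "(\<lambda>i. upr \<xi> (upr \<zeta> i)) = upr (\<lambda>i. \<xi> (\<zeta> i))" for \<xi> \<zeta>
    by (rule ext) (auto simp: upr_def split: nat.split)
  { case Fun then show ?case by (simp add: eq) }
  { case Lam then show ?case by (simp add: eq) }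
qed simp_all

lemma sb_ren: "sb \<sigma> (ren \<zeta> t) = sb (\<lambda>i. \<sigma> (\<zeta> i)) t"
proof (induction t arbitrary: \<sigma> \<zeta>)
  have eq: "(\<lambda>i. up \<sigma> (upr \<zeta> i)) = up (\<lambda>i. \<sigma> (\<zeta> i))" for \<sigma> \<zeta>
    by (rule ext) (auto simp: upr_def up_def scons_def split: nat.split)
  { case Fun then show ?case by (simp add: eq) }
  { case Lam then show ?case by (simp add: eq) }
qed simp_all

lemma ren_sb: "ren \<xi> (sb \<sigma> t) = sb (\<lambda>i. ren \<xi> (\<sigma> i)) t"
proof (induction t arbitrary: \<sigma> \<xi>)
  have eq: "(\<lambda>i. ren (upr \<xi>) (up \<sigma> i)) = up (\<lambda>i. ren \<xi> (\<sigma> i))" for \<sigma> \<xi>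
    by (rule ext) (auto simp: up_def scons_def lift0_ren ren_ren split: nat.split)
  { case Fun then show ?case by (simp add: eq) }
  { case Lam then show ?case by (simp add: eq) }
qed simp_all

text \<open>Under a binder the entries are shifted by a renaming, so the mixed laws
  \<open>sb_ren\<close> and \<open>ren_sb\<close> must come first, just as \<open>ren_sb\<close>
  rests on \<open>ren_ren\<close>.\<close>

lemma sb_sb: "sb \<tau> (sb \<sigma> t) = sb (\<lambda>i. sb \<tau> (\<sigma> i)) t"
proof (induction t arbitrary: \<sigma> \<tau>)
  have eq: "(\<lambda>i. sb (up \<tau>) (up \<sigma> i)) = up (\<lambda>i. sb \<tau> (\<sigma> i))" for \<sigma> \<tau>
    by (rule ext) (auto simp: up_def scons_def lift0_ren sb_ren ren_sb split: nat.split)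
  { case Fun then show ?case by (simp add: eq) }
  { case Lam then show ?case by (simp add: eq) }
qed simp_all

lemma up_Var [simp]: "up Var = Var"
  by (rule ext) (auto simp: up_def scons_def split: nat.split)

lemma sb_Var [simp]: "sb Var t = t"
  by (induction t) simp_all

lemma sb_lift0: "sb \<sigma> (lift 0 t) = sb (\<lambda>i. \<sigma> (Suc i)) t"
  by (simp add: lift0_ren sb_ren)

lemma lift0_sb: "lift 0 t = sb (\<lambda>i. Var (Suc i)) t"
  using sb_ren[of Var Suc t] by (simp add: lift0_ren)

lemma sb_scons_lift0 [simp]: "sb (u \<cdot> \<sigma>) (lift 0 t) = sb \<sigma> t"
  by (simp add: sb_lift0)

lemma sb_up_lift0 [simp]: "sb (up \<sigma>) (lift 0 t) = lift 0 (sb \<sigma> t)"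
  by (simp add: sb_lift0) (simp add: lift0_ren ren_sb)

lemma sb_scons_up [simp]: "sb (u \<cdot> \<tau>) (sb (up \<sigma>) t) = sb (u \<cdot> (\<lambda>i. sb \<tau> (\<sigma> i))) t"
proof -
  have "(\<lambda>i. sb (u \<cdot> \<tau>) (up \<sigma> i)) = u \<cdot> (\<lambda>i. sb \<tau> (\<sigma> i))"
    by (rule ext) (auto simp: up_def scons_def[of _ _ "_ :: nat"] split: nat.split)
  then show ?thesis by (simp add: sb_sb)
qed

text \<open>The bridge between the typing rules, which instantiate a bound variable, and the
  semantics, which extends a substitution.\<close>

lemma subst0_up: "subst 0 u (sb (up \<sigma>) t) = sb (u \<cdot> \<sigma>) t"
  by (simp add: subst0_sb)

lemma sb_scons_Var: "sb \<sigma> (sb (u \<cdot> Var) t) = sb (sb \<sigma> u \<cdot> \<sigma>) t"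
proof -
  have "(\<lambda>i. sb \<sigma> ((u \<cdot> Var) i)) = sb \<sigma> u \<cdot> \<sigma>"
    by (rule ext) (auto simp: scons_def split: nat.split)
  then show ?thesis by (simp add: sb_sb)
qed

lemma sb_subst0: "sb \<sigma> (subst 0 u t) = sb (sb \<sigma> u \<cdot> \<sigma>) t"
  by (simp add: subst0_sb sb_scons_Var)

lemma scons_eta: "\<sigma> 0 \<cdot> (\<lambda>i. \<sigma> (Suc i)) = \<sigma>"
  by (rule ext) (auto simp: scons_def split: nat.split)

lemma lift_lift_ren: "(lift 0 ^^ n) t = ren (\<lambda>i. i + n) t"
proof (induction n)
  case 0
  have "ren (\<lambda>i. i) t = t"
    using sb_Var[of t] sb_ren[of Var "\<lambda>i. i" t] ren_sb[of "\<lambda>i. i" Var t] by simp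
  then show ?case by simp
qed (simp add: lift0_ren ren_ren)

lemma sb_lifts: "sb \<sigma> ((lift 0 ^^ n) t) = sb (\<lambda>i. \<sigma> (i + n)) t"
  by (simp add: lift_lift_ren sb_ren)


section \<open>Renaming, substitution and validity\<close>

lemma ctx_wf:
  "\<turnstile> \<Gamma> \<Longrightarrow> True"
  "\<Gamma> \<turnstile> t \<^bold>: T \<Longrightarrow> \<turnstile> \<Gamma>"
  "\<Gamma> \<turnstile> t \<^bold>= t' \<^bold>: T \<Longrightarrow> \<turnstile> \<Gamma>"
proof (induction rule: wf_ctx_typing_equality.inducts)
  case eq_beta
  \<comment> \<open>For an irrelevant argument the second premise only speaks of the resurrected
    context, so \<open>\<Gamma>\<close> is recovered as the tail of the context of the body.\<close>
  from eq_beta.IH(1) show ?case by (cases rule: wf_ctx.cases) auto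
qed auto

lemma ctx_wf_tail: assumes "\<turnstile> (a, U) # \<Gamma>" shows "\<turnstile> \<Gamma>" "\<exists>s. \<Gamma> \<turnstile> U \<^bold>: Sort s"
  using assms by (cases rule: wf_ctx.cases; auto)+

text \<open>Inversion on the subject is harmless: besides \<open>ty_pi\<close> only
  \<open>ty_conv\<close> can type a function type, and it keeps the subject. The annotations in the
  syntax fix both sorts exactly.\<close>

lemma typing_Fun_inv_aux:
  "\<turnstile> \<Gamma> \<Longrightarrow> True"
  "\<Gamma> \<turnstile> t \<^bold>: X \<Longrightarrow> t = Fun a s s' U T \<Longrightarrow> \<Gamma> \<turnstile> U \<^bold>: Sort s \<and> (a, U) # \<Gamma> \<turnstile> T \<^bold>: Sort s'"
  "\<Gamma> \<turnstile> t \<^bold>= t' \<^bold>: X \<Longrightarrow> True"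
  by (induction rule: wf_ctx_typing_equality.inducts) auto

lemma typing_Fun_inv:
  assumes "\<Gamma> \<turnstile> Fun a s s' U T \<^bold>: X"
  shows "\<Gamma> \<turnstile> U \<^bold>: Sort s" "(a, U) # \<Gamma> \<turnstile> T \<^bold>: Sort s'"
  using typing_Fun_inv_aux(2)[OF assms] by blast+

section \<open>Monotonicity in the relevance annotations\<close>

definition annot_le :: "ctx \<Rightarrow> ctx \<Rightarrow> bool" where
  "annot_le = list_all2 (\<lambda>(a, T) (b, T'). T = T' \<and> (a = b \<or> b = Rel))"

lemma annot_le_Cons: "annot_le \<Gamma> \<Delta> \<Longrightarrow> annot_le ((a, U) # \<Gamma>) ((a, U) # \<Delta>)"
  by (simp add: annot_le_def)

lemma annot_le_nth: "annot_le \<Gamma> \<Delta> \<Longrightarrow> i < length \<Gamma> \<Longrightarrow> \<Gamma> ! i = (Rel, U) \<Longrightarrow>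
    i < length \<Delta> \<and> \<Delta> ! i = (Rel, U)"
  unfolding annot_le_def by (cases "\<Delta> ! i") (auto simp: list_all2_conv_all_nth)

lemma annot_le_resurrect: "annot_le \<Gamma> (resurrect \<Gamma>)"
  unfolding annot_le_def resurrect_def by (auto simp: list_all2_conv_all_nth split: prod.splits)

lemma annot_le_resurrect2: "annot_le \<Gamma> \<Delta> \<Longrightarrow> annot_le (resurrect \<Gamma>) (resurrect \<Delta>)"
  unfolding annot_le_def resurrect_def
  by (auto simp: list_all2_conv_all_nth split: prod.splits)

lemma annot_le_ctx_for: "annot_le \<Gamma> \<Delta> \<Longrightarrow> annot_le (ctx_for a \<Gamma>) (ctx_for a \<Delta>)"
  by (cases a) (simp_all add: annot_le_resurrect2)

text \<open>The variable rule asks for relevance and no rule asks for irrelevance, so upgrading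
  bindings keeps derivations. A direct induction for \<open>resurrect\<close> would fail under an
  irrelevant binder, whose new binding has to keep its annotation; hence an order in which only some
  bindings are upgraded.\<close>

lemma annot_mono:
  "\<turnstile> \<Gamma> \<Longrightarrow> annot_le \<Gamma> \<Delta> \<Longrightarrow> \<turnstile> \<Delta>"
  "\<Gamma> \<turnstile> t \<^bold>: T \<Longrightarrow> annot_le \<Gamma> \<Delta> \<Longrightarrow> \<Delta> \<turnstile> t \<^bold>: T"
  "\<Gamma> \<turnstile> t \<^bold>= t' \<^bold>: T \<Longrightarrow> annot_le \<Gamma> \<Delta> \<Longrightarrow> \<Delta> \<turnstile> t \<^bold>= t' \<^bold>: T"
proof (induction arbitrary: \<Delta> and \<Delta> and \<Delta> rule: wf_ctx_typing_equality.inducts)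
  case wf_empty
  then show ?case by (auto simp: annot_le_def intro: wf_ctx_typing_equality.intros)
next
  case (wf_ext \<Gamma> T s a)
  from wf_ext.prems obtain b \<Delta>' where "\<Delta> = (b, T) # \<Delta>'" "annot_le \<Gamma> \<Delta>'"
    by (auto simp: annot_le_def list_all2_Cons1)
  with wf_ext.IH show ?case by (blast intro: wf_ctx_typing_equality.wf_ext)
next
  case (eq_app_irr \<Gamma> t t' s s' U T u u')
  then show ?case
    by (metis annot_le_ctx_for wf_ctx_typing_equality.eq_app_irr)
next
  case ty_var
  then show ?case using annot_le_nth wf_ctx_typing_equality.ty_var by blast
next
  case ty_pi then show ?case by (metis annot_le_Cons wf_ctx_typing_equality.ty_pi)
next
  case ty_lam then show ?case by (metis annot_le_Cons wf_ctx_typing_equality.ty_lam)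
next
  case ty_app then show ?case by (metis annot_le_ctx_for wf_ctx_typing_equality.ty_app)
next
  case eq_beta then show ?case by (metis annot_le_Cons annot_le_ctx_for wf_ctx_typing_equality.eq_beta)
next
  case eq_pi then show ?case by (metis annot_le_Cons wf_ctx_typing_equality.eq_pi)
next
  case eq_lam then show ?case by (metis annot_le_Cons wf_ctx_typing_equality.eq_lam)
qed (blast intro: wf_ctx_typing_equality.intros)+

lemma resurrect_mono:
  "\<turnstile> \<Gamma> \<Longrightarrow> \<turnstile> resurrect \<Gamma>"
  "\<Gamma> \<turnstile> t \<^bold>: T \<Longrightarrow> resurrect \<Gamma> \<turnstile> t \<^bold>: T"
  "\<Gamma> \<turnstile> t \<^bold>= t' \<^bold>: T \<Longrightarrow> resurrect \<Gamma> \<turnstile> t \<^bold>= t' \<^bold>: T"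
  using annot_mono annot_le_resurrect by blast+

lemma ctx_for_mono:
  "\<turnstile> \<Gamma> \<Longrightarrow> \<turnstile> ctx_for a \<Gamma>"
  "\<Gamma> \<turnstile> t \<^bold>: T \<Longrightarrow> ctx_for a \<Gamma> \<turnstile> t \<^bold>: T"
  "\<Gamma> \<turnstile> t \<^bold>= t' \<^bold>: T \<Longrightarrow> ctx_for a \<Gamma> \<turnstile> t \<^bold>= t' \<^bold>: T"
  by (cases a; simp add: resurrect_mono)+

lemma length_resurrect [simp]: "length (resurrect \<Gamma>) = length \<Gamma>"
  by (simp add: resurrect_def)

lemma nth_resurrect: "i < length \<Gamma> \<Longrightarrow> resurrect \<Gamma> ! i = (Rel, snd (\<Gamma> ! i))"
  by (simp add: resurrect_def split: prod.split)

lemma length_ctx_for [simp]: "length (ctx_for a \<Gamma>) = length \<Gamma>"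
  by (cases a) simp_all

text \<open>Renaming and substitution are both instances of this locale. Renaming has to come first, because
  it yields the weakening that substitution needs for \<open>ext\<close>.\<close>

locale morphism =
  fixes Q :: "ctx \<Rightarrow> ctx \<Rightarrow> (nat \<Rightarrow> tm) \<Rightarrow> bool"
  assumes wf: "Q \<Delta> \<Gamma> \<sigma> \<Longrightarrow> \<turnstile> \<Delta>"
    and var: "Q \<Delta> \<Gamma> \<sigma> \<Longrightarrow> i < length \<Gamma> \<Longrightarrow> \<Gamma> ! i = (Rel, U) \<Longrightarrow>
      \<Delta> \<turnstile> \<sigma> i \<^bold>: sb \<sigma> ((lift 0 ^^ Suc i) U)"
    and res: "Q \<Delta> \<Gamma> \<sigma> \<Longrightarrow> Q (resurrect \<Delta>) (resurrect \<Gamma>) \<sigma>"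
    and ext: "Q \<Delta> \<Gamma> \<sigma> \<Longrightarrow> \<Delta> \<turnstile> sb \<sigma> U \<^bold>: Sort s \<Longrightarrow> Q ((a, sb \<sigma> U) # \<Delta>) ((a, U) # \<Gamma>) (up \<sigma>)"
begin

lemma res_for: "Q \<Delta> \<Gamma> \<sigma> \<Longrightarrow> Q (ctx_for a \<Delta>) (ctx_for a \<Gamma>) \<sigma>"
  by (cases a) (simp_all add: res)

text \<open>The context is part of the induction hypothesis because the premises of \<open>eq_beta\<close> do not
  include a typing of the domain \<open>U\<close>.\<close>

definition types_preserved :: "ctx \<Rightarrow> bool" where
  "types_preserved \<Gamma> \<longleftrightarrow> (\<forall>n < length \<Gamma>. \<exists>s. \<forall>\<Delta> \<sigma>. Q \<Delta> (drop (Suc n) \<Gamma>) \<sigma> \<longrightarrow>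
     \<Delta> \<turnstile> sb \<sigma> (snd (\<Gamma> ! n)) \<^bold>: Sort s)"

lemma types_preserved_Cons: "types_preserved ((a, U) # \<Gamma>) \<longleftrightarrow>
    types_preserved \<Gamma> \<and> (\<exists>s. \<forall>\<Delta> \<sigma>. Q \<Delta> \<Gamma> \<sigma> \<longrightarrow> \<Delta> \<turnstile> sb \<sigma> U \<^bold>: Sort s)"
  by (auto simp: types_preserved_def All_less_Suc2)

lemma preserves:
  "\<turnstile> \<Gamma> \<Longrightarrow> types_preserved \<Gamma>"
  "\<Gamma> \<turnstile> t \<^bold>: T \<Longrightarrow> types_preserved \<Gamma> \<and> (\<forall>\<Delta> \<sigma>. Q \<Delta> \<Gamma> \<sigma> \<longrightarrow> \<Delta> \<turnstile> sb \<sigma> t \<^bold>: sb \<sigma> T)"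
  "\<Gamma> \<turnstile> t \<^bold>= t' \<^bold>: T \<Longrightarrow> types_preserved \<Gamma> \<and> (\<forall>\<Delta> \<sigma>. Q \<Delta> \<Gamma> \<sigma> \<longrightarrow> \<Delta> \<turnstile> sb \<sigma> t \<^bold>= sb \<sigma> t' \<^bold>: sb \<sigma> T)"
proof (induction rule: wf_ctx_typing_equality.inducts)
  case wf_empty
  then show ?case by (simp add: types_preserved_def)
next
  case (wf_ext \<Gamma> T s a)
  then show ?case by (auto simp: types_preserved_Cons)
next
  case (ty_sort \<Gamma> s s')
  then show ?case by (auto intro: wf_ctx_typing_equality.ty_sort wf)
next
  case (ty_pi \<Gamma> U s1 a T s2 s3)
  then show ?case by (auto intro!: wf_ctx_typing_equality.ty_pi) (metis ext)
next
  case (ty_var \<Gamma> i U)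
  then show ?case using var by auto
next
  case (ty_lam a U \<Gamma> t T s s' s'')
  then show ?case
    by (auto intro!: wf_ctx_typing_equality.ty_lam)
      (metis ext typing_Fun_inv(1))
next
  case (ty_app \<Gamma> t a s s' U T u)
  then show ?case
    by (auto simp: sb_subst0) (metis res_for subst0_up wf_ctx_typing_equality.ty_app)
next
  case (ty_conv \<Gamma> t T T' s)
  then show ?case by simp (blast intro: wf_ctx_typing_equality.ty_conv)
next
  case (eq_beta a U \<Gamma> t T u)
  then show ?case
    by (auto simp: sb_subst0 types_preserved_Cons)
      (metis ext res_for subst0_up wf_ctx_typing_equality.eq_beta)
next
  case (eq_eta \<Gamma> t a s s' U T)
  then show ?case
    by auto (metis wf_ctx_typing_equality.eq_eta)
next
  case (eq_refl \<Gamma> t T)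
  then show ?case by (auto intro: wf_ctx_typing_equality.eq_refl)
next
  case (eq_sym \<Gamma> t t' T)
  then show ?case by (blast intro: wf_ctx_typing_equality.eq_sym)
next
  case (eq_trans \<Gamma> t t' T t'')
  then show ?case by (blast intro: wf_ctx_typing_equality.eq_trans)
next
  case (eq_pi \<Gamma> U U' s1 a T T' s2 s3)
  \<comment> \<open>Validity comes later, so the equation for \<open>U\<close> does not yet give a
    typing of \<open>U\<close>; \<open>ext\<close> gets it from the invariant on the context of the
    codomain premise.\<close>
  then show ?case
    by (auto intro!: wf_ctx_typing_equality.eq_pi simp: types_preserved_Cons) (metis ext)
next
  case (eq_lam \<Gamma> U U' s1 a T s2 t t')
  then show ?case
    by (auto intro!: wf_ctx_typing_equality.eq_lam simp: types_preserved_Cons) (metis ext)+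
next
  case (eq_app_rel \<Gamma> t t' s s' U T u u')
  then show ?case
    by (auto simp: sb_subst0) (metis subst0_up wf_ctx_typing_equality.eq_app_rel)
next
  case (eq_app_irr \<Gamma> t t' s s' U T u u')
  then show ?case
    by (auto simp: sb_subst0) (metis res subst0_up wf_ctx_typing_equality.eq_app_irr ctx_for.simps(2))
next
  case (eq_conv \<Gamma> t t' T T' s)
  then show ?case by simp (blast intro: wf_ctx_typing_equality.eq_conv)
qed

end

text \<open>Types of corresponding bindings agree syntactically: if the images were only required to
  be typed, closure under \<open>ext\<close> would already presuppose weakening. Equal annotations
  make the notion stable under resurrection.\<close>

definition wk :: "ctx \<Rightarrow> ctx \<Rightarrow> (nat \<Rightarrow> tm) \<Rightarrow> bool" where
  "wk \<Delta> \<Gamma> \<sigma> \<longleftrightarrow> \<turnstile> \<Delta> \<and> (\<exists>\<xi>. \<sigma> = (\<lambda>i. Var (\<xi> i)) \<and> (\<forall>i < length \<Gamma>. \<xi> i < length \<Delta> \<and>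
     fst (\<Delta> ! \<xi> i) = fst (\<Gamma> ! i) \<and>
     (lift 0 ^^ Suc (\<xi> i)) (snd (\<Delta> ! \<xi> i)) = sb \<sigma> ((lift 0 ^^ Suc i) (snd (\<Gamma> ! i)))))"

interpretation wk: morphism wk
proof
  fix \<Delta> \<Gamma> \<sigma>
  assume Q: "wk \<Delta> \<Gamma> \<sigma>"
  then show "\<turnstile> \<Delta>" by (simp add: wk_def)
  show "wk (resurrect \<Delta>) (resurrect \<Gamma>) \<sigma>"
    using Q by (auto simp: wk_def nth_resurrect resurrect_mono)
  show "\<Delta> \<turnstile> \<sigma> i \<^bold>: sb \<sigma> ((lift 0 ^^ Suc i) U)" if "i < length \<Gamma>" "\<Gamma> ! i = (Rel, U)" for i U
  proof -
    from Q that obtain \<xi> where "\<sigma> = (\<lambda>i. Var (\<xi> i))" "\<xi> i < length \<Delta>" "fst (\<Delta> ! \<xi> i) = Rel"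
      "(lift 0 ^^ Suc (\<xi> i)) (snd (\<Delta> ! \<xi> i)) = sb \<sigma> ((lift 0 ^^ Suc i) U)"
      unfolding wk_def by fastforce
    then show ?thesis
      using ty_var[OF \<open>\<turnstile> \<Delta>\<close>, of "\<xi> i" "snd (\<Delta> ! \<xi> i)"] by (metis prod.collapse)
  qed
  show "wk ((a, sb \<sigma> U) # \<Delta>) ((a, U) # \<Gamma>) (up \<sigma>)" if U: "\<Delta> \<turnstile> sb \<sigma> U \<^bold>: Sort s" for a U s
  proof -
    from Q obtain \<xi> where \<sigma>: "\<sigma> = (\<lambda>i. Var (\<xi> i))" and \<xi>: "\<forall>i < length \<Gamma>. \<xi> i < length \<Delta> \<and>
     fst (\<Delta> ! \<xi> i) = fst (\<Gamma> ! i) \<and>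
     (lift 0 ^^ Suc (\<xi> i)) (snd (\<Delta> ! \<xi> i)) = sb \<sigma> ((lift 0 ^^ Suc i) (snd (\<Gamma> ! i)))"
      unfolding wk_def by blast
    have up: "up \<sigma> = (\<lambda>i. Var (upr \<xi> i))"
      by (rule ext) (auto simp: up_def upr_def scons_def \<sigma> split: nat.split)
    then show ?thesis
      using \<xi> \<open>\<turnstile> \<Delta>\<close> U unfolding wk_def
      by (intro conjI exI[of _ "upr \<xi>"]) (auto simp: up[symmetric] All_less_Suc2 intro: wf_ext)
  qed
qed

lemma wk_lift: "\<turnstile> (a, U) # \<Gamma> \<Longrightarrow> wk ((a, U) # \<Gamma>) \<Gamma> (\<lambda>i. Var (Suc i))"
  unfolding wk_def by (auto simp: lift0_sb intro!: exI[of _ Suc])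

lemma weakening:
  "\<Gamma> \<turnstile> t \<^bold>: T \<Longrightarrow> \<turnstile> (a, U) # \<Gamma> \<Longrightarrow> (a, U) # \<Gamma> \<turnstile> lift 0 t \<^bold>: lift 0 T"
  "\<Gamma> \<turnstile> t \<^bold>= t' \<^bold>: T \<Longrightarrow> \<turnstile> (a, U) # \<Gamma> \<Longrightarrow> (a, U) # \<Gamma> \<turnstile> lift 0 t \<^bold>= lift 0 t' \<^bold>: lift 0 T"
  using wk.preserves(2,3) wk_lift by (simp_all add: lift0_sb)

text \<open>An entry for an irrelevant binding is only typed in the resurrected target, mirroring
  irrelevant application. This suffices because such a binding can be used only after resurrecting
  the source, which resurrects the target as well.\<close>

definition sub :: "ctx \<Rightarrow> ctx \<Rightarrow> (nat \<Rightarrow> tm) \<Rightarrow> bool" where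
  "sub \<Delta> \<Gamma> \<sigma> \<longleftrightarrow> \<turnstile> \<Delta> \<and> (\<forall>i < length \<Gamma>.
     ctx_for (fst (\<Gamma> ! i)) \<Delta> \<turnstile> \<sigma> i \<^bold>: sb \<sigma> ((lift 0 ^^ Suc i) (snd (\<Gamma> ! i))))"

lemma ty_var0: "\<turnstile> (Rel, U) # \<Gamma> \<Longrightarrow> (Rel, U) # \<Gamma> \<turnstile> Var 0 \<^bold>: lift 0 U"
  using ty_var[of "(Rel, U) # \<Gamma>" 0 U] by simp

lemma ctx_for_Cons: "ctx_for b ((a, U) # \<Gamma>) = (case b of Rel \<Rightarrow> a | Irr \<Rightarrow> Rel, U) # ctx_for b \<Gamma>"
  by (cases b) (simp_all add: resurrect_def)

lemma ty_var0_for: "\<turnstile> (a, U) # \<Gamma> \<Longrightarrow> ctx_for a ((a, U) # \<Gamma>) \<turnstile> Var 0 \<^bold>: lift 0 U"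
  using ctx_for_mono(1)[of "(a, U) # \<Gamma>" a]
  by (cases a) (simp_all add: ty_var0 resurrect_def)

interpretation sub: morphism sub
proof
  fix \<Delta> \<Gamma> \<sigma>
  assume Q: "sub \<Delta> \<Gamma> \<sigma>"
  then show wf: "\<turnstile> \<Delta>" by (simp add: sub_def)
  have "resurrect \<Delta> \<turnstile> t \<^bold>: T" if "ctx_for a \<Delta> \<turnstile> t \<^bold>: T" for a t T
    using that by (cases a) (simp_all add: resurrect_mono)
  with Q show "sub (resurrect \<Delta>) (resurrect \<Gamma>) \<sigma>"
    by (auto simp: sub_def nth_resurrect resurrect_mono)
  show "\<Delta> \<turnstile> \<sigma> i \<^bold>: sb \<sigma> ((lift 0 ^^ Suc i) U)" if "i < length \<Gamma>" "\<Gamma> ! i = (Rel, U)" for i U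
    using Q that unfolding sub_def by fastforce
  show "sub ((a, sb \<sigma> U) # \<Delta>) ((a, U) # \<Gamma>) (up \<sigma>)" if U: "\<Delta> \<turnstile> sb \<sigma> U \<^bold>: Sort s" for a U s
  proof -
    have wf': "\<turnstile> (a, sb \<sigma> U) # \<Delta>" using wf U by (rule wf_ext)
    show ?thesis
      using Q unfolding sub_def
      by (auto simp: All_less_Suc2 wf' ty_var0_for)
        (metis ctx_for_Cons ctx_for_mono(1) weakening(1) wf')
  qed
qed

lemma sub_ty: "\<Gamma> \<turnstile> t \<^bold>: T \<Longrightarrow> sub \<Delta> \<Gamma> \<sigma> \<Longrightarrow> \<Delta> \<turnstile> sb \<sigma> t \<^bold>: sb \<sigma> T"
  and sub_eq: "\<Gamma> \<turnstile> t \<^bold>= t' \<^bold>: T \<Longrightarrow> sub \<Delta> \<Gamma> \<sigma> \<Longrightarrow> \<Delta> \<turnstile> sb \<sigma> t \<^bold>= sb \<sigma> t' \<^bold>: sb \<sigma> T"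
  using sub.preserves by blast+

lemma sub_Var: assumes "\<turnstile> \<Gamma>" shows "sub \<Gamma> \<Gamma> Var"
proof -
  have "ctx_for (fst (\<Gamma> ! i)) \<Gamma> \<turnstile> Var i \<^bold>: (lift 0 ^^ Suc i) (snd (\<Gamma> ! i))" if "i < length \<Gamma>" for i
  proof (rule ty_var)
    show "ctx_for (fst (\<Gamma> ! i)) \<Gamma> ! i = (Rel, snd (\<Gamma> ! i))"
      using that by (cases "\<Gamma> ! i"; cases "fst (\<Gamma> ! i)") (simp_all add: nth_resurrect)
  qed (use that assms ctx_for_mono(1) in simp_all)
  with assms show ?thesis by (simp add: sub_def)
qed

lemma sub_scons: "sub \<Delta> \<Gamma> \<sigma> \<Longrightarrow> ctx_for a \<Delta> \<turnstile> u \<^bold>: sb \<sigma> U \<Longrightarrow> sub \<Delta> ((a, U) # \<Gamma>) (u \<cdot> \<sigma>)"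
  by (auto simp: sub_def All_less_Suc2)

lemma sub_tail: "sub \<Delta> ((a, U) # \<Gamma>) \<sigma> \<Longrightarrow> sub \<Delta> \<Gamma> (\<lambda>i. \<sigma> (Suc i))"
  by (auto simp: sub_def All_less_Suc2 sb_lift0)

lemma subst_ty:
  assumes t: "(a, U) # \<Gamma> \<turnstile> t \<^bold>: T" and u: "ctx_for a \<Gamma> \<turnstile> u \<^bold>: U"
  shows "\<Gamma> \<turnstile> subst 0 u t \<^bold>: subst 0 u T"
proof -
  have "\<turnstile> \<Gamma>" using ctx_wf_tail(1)[OF ctx_wf(2)[OF t]] .
  with u have "sub \<Gamma> ((a, U) # \<Gamma>) (u \<cdot> Var)" by (simp add: sub_scons sub_Var)
  from sub_ty[OF t this] show ?thesis by (simp add: subst0_sb)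
qed

text \<open>The identity is a substitution between the two contexts: only the innermost variable
  changes its type, and the conversion rule restores the old one.\<close>

lemma ctx_conv:
  assumes "\<Gamma> \<turnstile> U \<^bold>= U' \<^bold>: Sort s" "\<Gamma> \<turnstile> U' \<^bold>: Sort s"
  shows "(a, U) # \<Gamma> \<turnstile> t \<^bold>: T \<Longrightarrow> (a, U') # \<Gamma> \<turnstile> t \<^bold>: T"
    "(a, U) # \<Gamma> \<turnstile> t \<^bold>= t' \<^bold>: T \<Longrightarrow> (a, U') # \<Gamma> \<turnstile> t \<^bold>= t' \<^bold>: T"
proof -
  have wf: "\<turnstile> (a, U') # \<Gamma>" using ctx_wf(2) wf_ext assms(2) by blast
  have "ctx_for a ((a, U') # \<Gamma>) \<turnstile> Var 0 \<^bold>: lift 0 U"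
    using ty_conv[OF ty_var0_for[OF wf] ctx_for_mono(3)[OF weakening(2)[OF eq_sym[OF assms(1)] wf, simplified]]]
    by simp
  then have "sub ((a, U') # \<Gamma>) ((a, U) # \<Gamma>) Var"
    using sub_Var[OF wf] by (auto simp: sub_def All_less_Suc2)
  then show "(a, U) # \<Gamma> \<turnstile> t \<^bold>: T \<Longrightarrow> (a, U') # \<Gamma> \<turnstile> t \<^bold>: T"
    "(a, U) # \<Gamma> \<turnstile> t \<^bold>= t' \<^bold>: T \<Longrightarrow> (a, U') # \<Gamma> \<turnstile> t \<^bold>= t' \<^bold>: T"
    using sub_ty sub_eq by fastforce+
qed

section \<open>Functionality of substitution and syntactic validity\<close>

lemma Rule_ex: "\<exists>s3. (s1, s2, s3) \<in> Rule"
  by (cases s1; cases s2) (auto simp: Rule_def)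

lemma Axiom_ex: "\<exists>s'. (s, s') \<in> Axiom"
  by (cases s) (auto simp: Axiom_def)

lemma Axiom_typed: "\<turnstile> \<Gamma> \<Longrightarrow> \<exists>s'. \<Gamma> \<turnstile> Sort s \<^bold>: Sort s'"
  using Axiom_ex ty_sort by blast

text \<open>Equality at an annotation, arranged so that the two application congruences become the
  single rule \<open>eq_app\<close>. The typings are stored for relevant arguments too, as validity
  is not yet available.\<close>

definition arg_eq :: "annot \<Rightarrow> ctx \<Rightarrow> tm \<Rightarrow> tm \<Rightarrow> tm \<Rightarrow> bool" where
  "arg_eq a \<Gamma> u u' U \<longleftrightarrow> ctx_for a \<Gamma> \<turnstile> u \<^bold>: U \<and> ctx_for a \<Gamma> \<turnstile> u' \<^bold>: U \<and> (a = Rel \<longrightarrow> \<Gamma> \<turnstile> u \<^bold>= u' \<^bold>: U)"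

lemma eq_app: "\<Gamma> \<turnstile> t \<^bold>= t' \<^bold>: Fun a s s' U T \<Longrightarrow> arg_eq a \<Gamma> u u' U \<Longrightarrow>
    \<Gamma> \<turnstile> App a t u \<^bold>= App a t' u' \<^bold>: subst 0 u T"
  by (cases a) (auto simp: arg_eq_def intro: eq_app_rel eq_app_irr)

text \<open>Equal functions send equal arguments to equal results, so beta turns the congruence rule for
  application into functionality of substitution.\<close>

lemma Lam_eq_subst:
  assumes lam: "\<Gamma> \<turnstile> Lam a U t \<^bold>= Lam a U' t' \<^bold>: Fun a s s' U T"
    and t: "(a, U) # \<Gamma> \<turnstile> t \<^bold>: T" "(a, U') # \<Gamma> \<turnstile> t' \<^bold>: T'"
    and u: "arg_eq a \<Gamma> u u' U" "ctx_for a \<Gamma> \<turnstile> u' \<^bold>: U'"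
    and T: "\<Gamma> \<turnstile> subst 0 u T \<^bold>= subst 0 u' T' \<^bold>: Sort r"
  shows "\<Gamma> \<turnstile> subst 0 u t \<^bold>= subst 0 u' t' \<^bold>: subst 0 u T"
proof -
  have "ctx_for a \<Gamma> \<turnstile> u \<^bold>: U" using u(1) by (simp add: arg_eq_def)
  then have "\<Gamma> \<turnstile> App a (Lam a U t) u \<^bold>= subst 0 u t \<^bold>: subst 0 u T" by (rule eq_beta[OF t(1)])
  moreover have "\<Gamma> \<turnstile> App a (Lam a U' t') u' \<^bold>= subst 0 u' t' \<^bold>: subst 0 u T"
    by (rule eq_conv[OF eq_beta[OF t(2) u(2)] eq_sym[OF T]])
  ultimately show ?thesis using eq_app[OF lam u(1)] by (metis eq_sym eq_trans)
qed

text \<open>A type family is a function into a sort: \<open>Lam_eq_subst\<close> applies to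
  \<open>Lam a U T\<close> with the constant codomain \<open>Sort r\<close>. The result serves
  \<open>validity\<close>, where the right-hand application must be moved from the type at
  \<open>u'\<close> to the type at \<open>u\<close>.\<close>

lemma subst_type_eq:
  assumes T: "(a, U) # \<Gamma> \<turnstile> T \<^bold>: Sort r" and u: "arg_eq a \<Gamma> u u' U"
  shows "\<Gamma> \<turnstile> subst 0 u T \<^bold>= subst 0 u' T \<^bold>: Sort r"
proof -
  from T obtain s where U: "\<Gamma> \<turnstile> U \<^bold>: Sort s" using ctx_wf(2) ctx_wf_tail(2) by blast
  from Axiom_typed ctx_wf(2)[OF T] obtain r' where "(a, U) # \<Gamma> \<turnstile> Sort r \<^bold>: Sort r'" by blast
  with U Rule_ex obtain q where "\<Gamma> \<turnstile> Fun a s r' U (Sort r) \<^bold>: Sort q" by (metis ty_pi)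
  with T have "\<Gamma> \<turnstile> Lam a U T \<^bold>: Fun a s r' U (Sort r)" by (rule ty_lam)
  moreover obtain q' where "\<Gamma> \<turnstile> Sort r \<^bold>: Sort q'" using Axiom_typed ctx_wf(2)[OF U] by blast
  ultimately show ?thesis
    using Lam_eq_subst[OF eq_refl T T u] u eq_refl by (fastforce simp: arg_eq_def)
qed

lemma validity:
  "\<turnstile> \<Gamma> \<Longrightarrow> True"
  "\<Gamma> \<turnstile> t \<^bold>: T \<Longrightarrow> \<exists>s. \<Gamma> \<turnstile> T \<^bold>: Sort s"
  "\<Gamma> \<turnstile> t \<^bold>= t' \<^bold>: T \<Longrightarrow> \<Gamma> \<turnstile> t \<^bold>: T \<and> \<Gamma> \<turnstile> t' \<^bold>: T \<and> (\<exists>s. \<Gamma> \<turnstile> T \<^bold>: Sort s)"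
proof (induction rule: wf_ctx_typing_equality.inducts)
  case (ty_sort \<Gamma> s s')
  then show ?case by (simp add: Axiom_typed)
next
  case (ty_pi \<Gamma> U s1 a T s2 s3)
  then show ?case using ctx_wf(2) by (meson Axiom_typed)
next
  case (ty_var \<Gamma> i U)
  \<comment> \<open>The type of a variable is well-formed in the context after its binding; it is
    weakened over the bindings of \<open>\<Xi>\<close> one at a time.\<close>
  have "\<Gamma> = \<Xi> @ (Rel, U) # \<Gamma>' \<Longrightarrow> \<turnstile> \<Gamma> \<Longrightarrow> \<exists>s. \<Gamma> \<turnstile> (lift 0 ^^ Suc (length \<Xi>)) U \<^bold>: Sort s" for \<Xi> \<Gamma> \<Gamma>'
  proof (induction \<Xi> arbitrary: \<Gamma>)
    case Nil
    then obtain s where "\<Gamma>' \<turnstile> U \<^bold>: Sort s" using ctx_wf_tail(2) by fastforce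
    from weakening(1)[OF this] Nil show ?case by auto
  next
    case (Cons p \<Xi>)
    obtain b W where p: "p = (b, W)" by (cases p)
    with Cons obtain s where "\<Xi> @ (Rel, U) # \<Gamma>' \<turnstile> (lift 0 ^^ Suc (length \<Xi>)) U \<^bold>: Sort s"
      using ctx_wf_tail(1) by fastforce
    from weakening(1)[OF this] Cons.prems p show ?case by auto
  qed
  from this[OF id_take_nth_drop[of i \<Gamma>, unfolded \<open>\<Gamma> ! i = (Rel, U)\<close>] \<open>\<turnstile> \<Gamma>\<close>] ty_var(2)
  show ?case by simp
next
  case (ty_app \<Gamma> t a s s' U T u)
  then obtain r where "\<Gamma> \<turnstile> Fun a s s' U T \<^bold>: Sort r" by blast
  from subst_ty[OF typing_Fun_inv(2)[OF this] ty_app(2)] show ?case by auto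
next
  case (eq_beta a U \<Gamma> t T u)
  then obtain s' where T: "(a, U) # \<Gamma> \<turnstile> T \<^bold>: Sort s'" by blast
  then obtain s where "\<Gamma> \<turnstile> U \<^bold>: Sort s" using ctx_wf(2) ctx_wf_tail(2) by blast
  with T Rule_ex obtain q where "\<Gamma> \<turnstile> Fun a s s' U T \<^bold>: Sort q" by (metis ty_pi)
  then have "\<Gamma> \<turnstile> Lam a U t \<^bold>: Fun a s s' U T" using eq_beta(1) by (rule ty_lam[rotated])
  then show ?case using eq_beta subst_ty[OF T eq_beta(2)] subst_ty[OF eq_beta(1,2)]
    by (auto intro: ty_app)
next
  case (eq_eta \<Gamma> t a s s' U T)
  then obtain r where F: "\<Gamma> \<turnstile> Fun a s s' U T \<^bold>: Sort r" by blast
  then have wf: "\<turnstile> (a, U) # \<Gamma>" using ctx_wf(2) typing_Fun_inv by blast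
  \<comment> \<open>Weakening puts the codomain in the scope of both its bound variable and the new
    context variable; instantiating the former by the latter merges them and gives back
    \<open>T\<close>.\<close>
  have eq: "subst 0 (Var 0) (sb (up (\<lambda>i. Var (Suc i))) T) = T"
    using scons_eta[of Var] by (simp add: subst0_up)
  from weakening(1)[OF eq_eta(1) wf]
  have "(a, U) # \<Gamma> \<turnstile> lift 0 t \<^bold>: Fun a s s' (lift 0 U) (sb (up (\<lambda>i. Var (Suc i))) T)"
    unfolding lift0_sb by simp
  from ty_app[OF this ty_var0_for[OF wf]]
  have "(a, U) # \<Gamma> \<turnstile> App a (lift 0 t) (Var 0) \<^bold>: T" by (simp add: eq)
  then show ?case using F eq_eta by (auto intro: ty_lam)
next
  case (eq_pi \<Gamma> U U' s1 a T T' s2 s3)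
  then show ?case using Axiom_typed ctx_wf(3) by (meson ty_pi ctx_conv(1))
next
  case (eq_lam \<Gamma> U U' s1 a T s2 t t')
  from Rule_ex obtain s3 where s3: "(s1, s2, s3) \<in> Rule" by blast
  have F: "\<Gamma> \<turnstile> Fun a s1 s2 U T \<^bold>: Sort s3" using eq_lam s3 by (auto intro: ty_pi)
  have U': "\<Gamma> \<turnstile> U' \<^bold>: Sort s1" using eq_lam by blast
  have F': "\<Gamma> \<turnstile> Fun a s1 s2 U' T \<^bold>: Sort s3" using eq_lam s3 U' ctx_conv(1) ty_pi by metis
  \<comment> \<open>A lambda is first typed with its own annotation as domain; congruence of
    function types then converts \<open>U'\<close> to \<open>U\<close>.\<close>
  have "\<Gamma> \<turnstile> Lam a U' t' \<^bold>: Fun a s1 s2 U' T" using eq_lam F' U' ctx_conv(1) ty_lam by metis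
  moreover have "\<Gamma> \<turnstile> Fun a s1 s2 U' T \<^bold>= Fun a s1 s2 U T \<^bold>: Sort s3"
    using eq_sym[OF wf_ctx_typing_equality.eq_pi[OF eq_lam(1) eq_refl[OF eq_lam(2)] s3]] .
  ultimately have "\<Gamma> \<turnstile> Lam a U' t' \<^bold>: Fun a s1 s2 U T" by (rule ty_conv)
  then show ?case using F eq_lam by (blast intro: ty_lam)
next
  case (eq_app_rel \<Gamma> t t' s s' U T u u')
  then obtain r where "\<Gamma> \<turnstile> Fun Rel s s' U T \<^bold>: Sort r" by blast
  then have T: "(Rel, U) # \<Gamma> \<turnstile> T \<^bold>: Sort s'" by (rule typing_Fun_inv)
  have u: "arg_eq Rel \<Gamma> u u' U" using eq_app_rel by (simp add: arg_eq_def)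
  have "\<Gamma> \<turnstile> subst 0 u T \<^bold>: Sort s'" using subst_ty[OF T, of u] eq_app_rel by simp
  then show ?case using eq_app_rel eq_sym[OF subst_type_eq[OF T u]]
    by (metis ty_app ty_conv ctx_for.simps)
next
  case (eq_app_irr \<Gamma> t t' s s' U T u u')
  then obtain r where "\<Gamma> \<turnstile> Fun Irr s s' U T \<^bold>: Sort r" by blast
  then have T: "(Irr, U) # \<Gamma> \<turnstile> T \<^bold>: Sort s'" by (rule typing_Fun_inv)
  have u: "arg_eq Irr \<Gamma> u u' U" using eq_app_irr by (simp add: arg_eq_def)
  have "\<Gamma> \<turnstile> subst 0 u T \<^bold>: Sort s'" using subst_ty[OF T, of u] eq_app_irr by simp
  then show ?case using eq_app_irr eq_sym[OF subst_type_eq[OF T u]]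
    by (metis ty_app ty_conv ctx_for.simps)
next
  case (eq_conv \<Gamma> t t' T T' s)
  then show ?case using ty_conv by fast
next
  case ty_conv then show ?case by fast
qed blast+


text \<open>Agreement on the indices outside \<open>\<Gamma>\<close> spares a lemma that typed terms are well-scoped.\<close>

definition sub_eqv :: "ctx \<Rightarrow> ctx \<Rightarrow> (nat \<Rightarrow> tm) \<Rightarrow> (nat \<Rightarrow> tm) \<Rightarrow> bool" where
  "sub_eqv \<Delta> \<Gamma> \<sigma> \<sigma>' \<longleftrightarrow> sub \<Delta> \<Gamma> \<sigma> \<and> sub \<Delta> \<Gamma> \<sigma>' \<and> (\<forall>i \<ge> length \<Gamma>. \<sigma> i = \<sigma>' i) \<and>
     (\<forall>i < length \<Gamma>. fst (\<Gamma> ! i) = Rel \<longrightarrow>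
       \<Delta> \<turnstile> \<sigma> i \<^bold>= \<sigma>' i \<^bold>: sb \<sigma> ((lift 0 ^^ Suc i) (snd (\<Gamma> ! i))))"

lemma sub_eqv_tail: "sub_eqv \<Delta> ((a, U) # \<Gamma>) \<sigma> \<sigma>' \<Longrightarrow> sub_eqv \<Delta> \<Gamma> (\<lambda>i. \<sigma> (Suc i)) (\<lambda>i. \<sigma>' (Suc i))"
  unfolding sub_eqv_def by (auto simp: All_less_Suc2 sb_lift0 intro: sub_tail)

text \<open>The induction is on the context, with the term arbitrary, rather than on derivations.
  The last variable is abstracted: the hypothesis for the shorter context applies to the lambda over
  it, and congruence of application together with beta reinstates the two entries.\<close>

lemma functionality:
  "sub_eqv \<Delta> \<Gamma> \<sigma> \<sigma>' \<Longrightarrow> \<Gamma> \<turnstile> t \<^bold>: T \<Longrightarrow> \<Delta> \<turnstile> sb \<sigma> t \<^bold>= sb \<sigma>' t \<^bold>: sb \<sigma> T"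
proof (induction \<Gamma> arbitrary: \<sigma> \<sigma>' t T)
  case Nil
  then have "\<sigma> = \<sigma>'" by (auto simp: sub_eqv_def)
  with Nil show ?case using sub_ty eq_refl unfolding sub_eqv_def by blast
next
  case (Cons p \<Gamma>)
  obtain a U where p: "p = (a, U)" by (cases p)
  note t = Cons.prems(2)[unfolded p]
  define \<tau> \<tau>' where \<tau>: "\<tau> = (\<lambda>i. \<sigma> (Suc i))" and \<tau>': "\<tau>' = (\<lambda>i. \<sigma>' (Suc i))"
  have eqv: "sub_eqv \<Delta> \<Gamma> \<tau> \<tau>'" using Cons.prems(1) sub_eqv_tail unfolding p \<tau> \<tau>' by blast
  note IH = Cons.IH[OF eqv]
  have sub: "sub \<Delta> \<Gamma> \<tau>" "sub \<Delta> \<Gamma> \<tau>'" using eqv unfolding sub_eqv_def by blast+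
  have \<sigma>: "\<sigma> = \<sigma> 0 \<cdot> \<tau>" and \<sigma>': "\<sigma>' = \<sigma>' 0 \<cdot> \<tau>'" unfolding \<tau> \<tau>' by (simp_all add: scons_eta)
  obtain s where U: "\<Gamma> \<turnstile> U \<^bold>: Sort s" using ctx_wf_tail(2)[OF ctx_wf(2)[OF t]] by blast
  obtain s' where T: "(a, U) # \<Gamma> \<turnstile> T \<^bold>: Sort s'" using validity(2)[OF t] by blast
  note eqU = IH[OF U, simplified]
  have U\<tau>: "\<Delta> \<turnstile> sb \<tau> U \<^bold>: Sort s" "\<Delta> \<turnstile> sb \<tau>' U \<^bold>: Sort s" using validity(3)[OF eqU] by blast+
  have u: "ctx_for a \<Delta> \<turnstile> \<sigma> 0 \<^bold>: sb \<tau> U" and u': "ctx_for a \<Delta> \<turnstile> \<sigma>' 0 \<^bold>: sb \<tau>' U"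
    using Cons.prems(1) unfolding p sub_eqv_def sub_def \<tau> \<tau>' by (auto simp: All_less_Suc2 sb_lift0)
  have "ctx_for a \<Delta> \<turnstile> \<sigma>' 0 \<^bold>: sb \<tau> U" by (rule ty_conv[OF u' ctx_for_mono(3)[OF eq_sym[OF eqU]]])
  moreover have "a = Rel \<longrightarrow> \<Delta> \<turnstile> \<sigma> 0 \<^bold>= \<sigma>' 0 \<^bold>: sb \<tau> U"
    using Cons.prems(1) unfolding p sub_eqv_def \<tau> by (auto simp: All_less_Suc2 sb_lift0)
  ultimately have arg: "arg_eq a \<Delta> (\<sigma> 0) (\<sigma>' 0) (sb \<tau> U)" using u by (simp add: arg_eq_def)
  have step: "\<Delta> \<turnstile> sb \<sigma> v \<^bold>= sb \<sigma>' v \<^bold>: sb \<sigma> V"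
    if v: "(a, U) # \<Gamma> \<turnstile> v \<^bold>: V" and V: "(a, U) # \<Gamma> \<turnstile> V \<^bold>: Sort r" "\<Delta> \<turnstile> sb \<sigma> V \<^bold>= sb \<sigma>' V \<^bold>: Sort r" for v V r
  proof -
    obtain q where "\<Gamma> \<turnstile> Fun a s r U V \<^bold>: Sort q" using ty_pi[OF U V(1)] Rule_ex by blast
    from IH[OF ty_lam[OF v this]]
    have lam: "\<Delta> \<turnstile> Lam a (sb \<tau> U) (sb (up \<tau>) v) \<^bold>= Lam a (sb \<tau>' U) (sb (up \<tau>') v)
        \<^bold>: Fun a s r (sb \<tau> U) (sb (up \<tau>) V)" by simp
    from Lam_eq_subst[OF lam sub_ty[OF v sub.ext[OF sub(1) U\<tau>(1)]] sub_ty[OF v sub.ext[OF sub(2) U\<tau>(2)]] arg u']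
    show ?thesis using V(2) unfolding subst0_up \<sigma>[symmetric] \<sigma>'[symmetric] by blast
  qed
  have wf: "\<turnstile> (a, U) # \<Gamma>" "\<turnstile> \<Delta>" using ctx_wf(2) t sub(1) by (auto simp: sub_def)
  obtain q where q: "(s', q) \<in> Axiom" using Axiom_ex by blast
  \<comment> \<open>\<open>step\<close> asks for an equation between the instances of the type. For
    \<open>T\<close> itself that is reflexivity at a sort, and the outcome then serves for
    \<open>t\<close>.\<close>
  have "\<Delta> \<turnstile> sb \<sigma> T \<^bold>= sb \<sigma>' T \<^bold>: Sort s'"
    using step[OF T ty_sort[OF wf(1) q]] eq_refl[OF ty_sort[OF wf(2) q]] by simp
  from step[OF t T this] show ?case .
qed

lemma functionality_eq:
  assumes eqv: "sub_eqv \<Delta> \<Gamma> \<sigma> \<sigma>'" and eq: "\<Gamma> \<turnstile> t \<^bold>= t' \<^bold>: T"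
  shows "\<Delta> \<turnstile> sb \<sigma> t \<^bold>= sb \<sigma>' t' \<^bold>: sb \<sigma> T"
proof -
  have "sub \<Delta> \<Gamma> \<sigma>" using eqv by (simp add: sub_eqv_def)
  moreover have "\<Gamma> \<turnstile> t' \<^bold>: T" using validity(3)[OF eq] by blast
  ultimately show ?thesis using eq_trans[OF sub_eq[OF eq] functionality[OF eqv]] by blast
qed

text \<open>One target context has to serve both sides. It binds \<open>sb \<sigma> U\<close>, so
  the new variable must be converted to \<open>sb \<sigma>' U\<close> before the lifted
  \<open>\<sigma>'\<close> is a substitution; functionality at \<open>U\<close> supplies the
  equation.\<close>

lemma sub_eqv_up:
  assumes eqv: "sub_eqv \<Delta> \<Gamma> \<sigma> \<sigma>'" and U: "\<Gamma> \<turnstile> U \<^bold>: Sort s"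
  shows "sub_eqv ((a, sb \<sigma> U) # \<Delta>) ((a, U) # \<Gamma>) (up \<sigma>) (up \<sigma>')"
proof -
  have sub: "sub \<Delta> \<Gamma> \<sigma>" "sub \<Delta> \<Gamma> \<sigma>'" and wf\<Delta>: "\<turnstile> \<Delta>" using eqv by (auto simp: sub_eqv_def sub_def)
  have eqU: "\<Delta> \<turnstile> sb \<sigma> U \<^bold>= sb \<sigma>' U \<^bold>: Sort s" using functionality[OF eqv U] by simp
  have U\<sigma>: "\<Delta> \<turnstile> sb \<sigma> U \<^bold>: Sort s" using sub_ty[OF U sub(1)] by simp
  then have wf: "\<turnstile> (a, sb \<sigma> U) # \<Delta>" using wf\<Delta> by (intro wf_ext)
  have "ctx_for a ((a, sb \<sigma> U) # \<Delta>) \<turnstile> Var 0 \<^bold>: lift 0 (sb \<sigma>' U)"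
    using ty_conv[OF ty_var0_for[OF wf] ctx_for_mono(3)[OF weakening(2)[OF eqU wf, simplified]]] .
  moreover have "ctx_for b ((a, sb \<sigma> U) # \<Delta>) \<turnstile> lift 0 t \<^bold>: lift 0 T" if "ctx_for b \<Delta> \<turnstile> t \<^bold>: T" for b t T
    using weakening(1)[OF that] ctx_for_mono(1)[OF wf, of b] by (simp add: ctx_for_Cons)
  ultimately have "sub ((a, sb \<sigma> U) # \<Delta>) ((a, U) # \<Gamma>) (up \<sigma>')"
    using sub(2) wf unfolding sub_def by (auto simp: All_less_Suc2)
  moreover have "sub ((a, sb \<sigma> U) # \<Delta>) ((a, U) # \<Gamma>) (up \<sigma>)" by (rule sub.ext[OF sub(1) U\<sigma>])
  moreover have "up \<sigma> i = up \<sigma>' i" if "i \<ge> length ((a, U) # \<Gamma>)" for i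
    using that eqv by (cases i) (auto simp: sub_eqv_def)
  moreover have "a = Rel \<Longrightarrow> (a, sb \<sigma> U) # \<Delta> \<turnstile> Var 0 \<^bold>= Var 0 \<^bold>: lift 0 (sb \<sigma> U)"
    using eq_refl[OF ty_var0] wf by simp
  ultimately show ?thesis
    using eqv unfolding sub_eqv_def by (auto simp: All_less_Suc2 intro: weakening(2)[OF _ wf])
qed


section \<open>Weak head reduction\<close>

inductive wstep :: "tm \<Rightarrow> tm \<Rightarrow> bool" (infix "\<leadsto>" 50) where
  wbeta: "App a (Lam a U t) u \<leadsto> subst 0 u t"
| wapp: "t \<leadsto> t' \<Longrightarrow> App a t u \<leadsto> App a t' u"

abbreviation wsteps :: "tm \<Rightarrow> tm \<Rightarrow> bool" (infix "\<leadsto>*" 50) where "wsteps \<equiv> wstep\<^sup>*\<^sup>*"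

text \<open>Only the head counts; arguments are arbitrary terms, since neutral types are compared by
  judgemental equality and not argument by argument.\<close>

primrec neutral :: "tm \<Rightarrow> bool" where
  "neutral (Sort s) = False"
| "neutral (Fun a s s' U T) = False"
| "neutral (Var i) = True"
| "neutral (Lam a U t) = False"
| "neutral (App a t u) = neutral t"

inductive_cases wstep_LamE: "Lam a U t \<leadsto> v"

lemma wstep_deterministic: "t \<leadsto> u \<Longrightarrow> t \<leadsto> v \<Longrightarrow> u = v"
proof (induction arbitrary: v rule: wstep.induct)
  case (wbeta a U t u)
  from wbeta.prems show ?case by (cases rule: wstep.cases) (auto elim: wstep_LamE)
next
  case (wapp t t' a u)
  from wapp.prems show ?case
  proof (cases rule: wstep.cases)
    case wbeta
    then show ?thesis using wapp.hyps wstep_LamE by blast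
  next
    case wapp2: (wapp t2)
    then show ?thesis using wapp.IH by simp
  qed
qed

definition whnf :: "tm \<Rightarrow> bool" where "whnf t \<longleftrightarrow> (\<forall>u. \<not> t \<leadsto> u)"

lemma neutral_step: "t \<leadsto> u \<Longrightarrow> \<not> neutral t"
  by (induction rule: wstep.induct) auto

lemma whnf_simps [simp]: "whnf (Sort s)" "whnf (Fun a s s' U T)" "neutral n \<Longrightarrow> whnf n"
  using neutral_step by (auto simp: whnf_def elim: wstep.cases)

lemma whnf_unique: "t \<leadsto>* u \<Longrightarrow> t \<leadsto>* v \<Longrightarrow> whnf u \<Longrightarrow> whnf v \<Longrightarrow> u = v"
proof (induction rule: converse_rtranclp_induct)
  case base
  then show ?case by (metis whnf_def converse_rtranclpE)
next
  case (step t t')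
  then show ?case by (metis whnf_def converse_rtranclpE wstep_deterministic)
qed

lemma wsteps_app: "t \<leadsto>* t' \<Longrightarrow> App a t u \<leadsto>* App a t' u"
  by (induction rule: rtranclp_induct) (auto intro: wapp rtranclp.rtrancl_into_rtrancl)


section \<open>The logical relation\<close>

definition whn :: "ctx \<Rightarrow> nat \<Rightarrow> tm \<Rightarrow> tm \<Rightarrow> bool" where
  "whn G k T X \<longleftrightarrow> T \<leadsto>* X \<and> G \<turnstile> T \<^bold>= X \<^bold>: Sort (Set k)"

definition rel_arg :: "ctx \<Rightarrow> annot \<Rightarrow> tm \<Rightarrow> (tm \<Rightarrow> tm \<Rightarrow> bool) \<Rightarrow> tm \<Rightarrow> tm \<Rightarrow> bool" where
  "rel_arg G a U P u u' = (case a of Rel \<Rightarrow> P u u'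
     | Irr \<Rightarrow> resurrect G \<turnstile> u \<^bold>: U \<and> resurrect G \<turnstile> u' \<^bold>: U)"

text \<open>The codomain relation is indexed by the left argument alone; that \<open>Q u\<close> and
  \<open>Q u'\<close> agree for related arguments follows from functionality and is shown when
  symmetry calls for it.\<close>

definition fun_rel where
  "fun_rel G a i j U V P Q = (\<lambda>f f'. G \<turnstile> f \<^bold>= f' \<^bold>: Fun a (Set i) (Set j) U V \<and>
     (\<forall>u u'. rel_arg G a U P u u' \<longrightarrow> Q u (App a f u) (App a f' u')))"

text \<open>\<open>LR G S k T T' R\<close> says that \<open>T\<close> and \<open>T'\<close> are related types of sort \<open>Set k\<close> whose terms are
  related by \<open>R\<close>. The parameter \<open>S j\<close> stands for the relation on the terms of \<open>Set j\<close>; it is only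
  used for \<open>j < k\<close>, so \<open>univ\<close> below can tie the knot by recursion on the level.\<close>

inductive LR :: "ctx \<Rightarrow> (nat \<Rightarrow> tm \<Rightarrow> tm \<Rightarrow> bool) \<Rightarrow> nat \<Rightarrow> tm \<Rightarrow> tm \<Rightarrow> (tm \<Rightarrow> tm \<Rightarrow> bool) \<Rightarrow> bool"
  for G S where
  LR_sort: "\<lbrakk>whn G k T (Sort (Set j)); whn G k T' (Sort (Set j)); k = Suc j;
    R = (\<lambda>t t'. G \<turnstile> t \<^bold>= t' \<^bold>: Sort (Set j) \<and> S j t t')\<rbrakk> \<Longrightarrow> LR G S k T T' R"
| LR_ne: "\<lbrakk>whn G k T n; whn G k T' n'; neutral n; neutral n'; G \<turnstile> n \<^bold>= n' \<^bold>: Sort (Set k);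
    R = (\<lambda>t t'. G \<turnstile> t \<^bold>= t' \<^bold>: T)\<rbrakk> \<Longrightarrow> LR G S k T T' R"
| LR_pi: "\<lbrakk>whn G k T (Fun a (Set i) (Set j) U V); whn G k T' (Fun a (Set i) (Set j) U' V'); k = max i j;
    G \<turnstile> U \<^bold>= U' \<^bold>: Sort (Set i); (a, U) # G \<turnstile> V \<^bold>= V' \<^bold>: Sort (Set j); LR G S i U U' P;
    \<And>u u'. rel_arg G a U P u u' \<Longrightarrow> LR G S j (subst 0 u V) (subst 0 u' V') (Q u);
    R = fun_rel G a i j U V P Q\<rbrakk> \<Longrightarrow> LR G S k T T' R"

text \<open>A sort that is a type at level \<open>k\<close> has level below \<open>k\<close>, and
  the components of a function type have levels at most \<open>max i j\<close>, so \<open>S\<close>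
  is consulted only below \<open>k\<close>.\<close>

lemma LR_cong: "LR G S k T T' R \<Longrightarrow> (\<forall>i < k. S i = S' i) \<Longrightarrow> LR G S' k T T' R"
proof (induction rule: LR.induct)
  case LR_sort then show ?case by (intro LR.LR_sort) auto
next
  case LR_ne show ?case by (rule LR.LR_ne[OF LR_ne(1-6)])
next
  case LR_pi
  show ?case by (rule LR.LR_pi[OF LR_pi(1-5)]) (use LR_pi in auto)
qed

section \<open>Inversion of the relation through weak head normal forms, and escape to judgemental
  equality\<close>

lemma eq_conv_iff: "G \<turnstile> T \<^bold>= T' \<^bold>: Sort s \<Longrightarrow> G \<turnstile> t \<^bold>= t' \<^bold>: T \<longleftrightarrow> G \<turnstile> t \<^bold>= t' \<^bold>: T'"
  using eq_conv eq_sym by blast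

lemma ty_conv_iff: "G \<turnstile> T \<^bold>= T' \<^bold>: Sort s \<Longrightarrow> G \<turnstile> t \<^bold>: T \<longleftrightarrow> G \<turnstile> t \<^bold>: T'"
  using ty_conv eq_sym by blast

lemma whn_steps: "whn G k T X \<Longrightarrow> T \<leadsto>* X"
  by (simp add: whn_def)

lemma whn_conv: "whn G k T X \<Longrightarrow> G \<turnstile> t \<^bold>= t' \<^bold>: T \<longleftrightarrow> G \<turnstile> t \<^bold>= t' \<^bold>: X"
  unfolding whn_def by (rule eq_conv_iff) blast

lemma whn_unique: "whn G k T X \<Longrightarrow> T \<leadsto>* Y \<Longrightarrow> whnf X \<Longrightarrow> whnf Y \<Longrightarrow> Y = X"
  unfolding whn_def using whnf_unique by blast

lemma LR_sort_left:
  assumes "LR G S k T T' R" "T \<leadsto>* Sort (Set j)"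
  shows "whn G k T' (Sort (Set j)) \<and> k = Suc j \<and> R = (\<lambda>t t'. G \<turnstile> t \<^bold>= t' \<^bold>: Sort (Set j) \<and> S j t t')"
  using assms(1) by (cases rule: LR.cases) (auto dest: whn_unique[OF _ assms(2)])

lemma LR_sort_right:
  assumes "LR G S k T T' R" "T' \<leadsto>* Sort (Set j)"
  shows "whn G k T (Sort (Set j)) \<and> k = Suc j \<and> R = (\<lambda>t t'. G \<turnstile> t \<^bold>= t' \<^bold>: Sort (Set j) \<and> S j t t')"
  using assms(1) by (cases rule: LR.cases) (auto dest: whn_unique[OF _ assms(2)])

lemma LR_ne_left:
  assumes "LR G S k T T' R" "T \<leadsto>* n" "neutral n"
  shows "\<exists>n'. whn G k T' n' \<and> neutral n' \<and> G \<turnstile> n \<^bold>= n' \<^bold>: Sort (Set k) \<and> R = (\<lambda>t t'. G \<turnstile> t \<^bold>= t' \<^bold>: T)"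
  using assms(1) by (cases rule: LR.cases) (use assms(3) in \<open>auto dest: whn_unique[OF _ assms(2)]\<close>)

lemma LR_ne_right:
  assumes "LR G S k T T' R" "T' \<leadsto>* n'" "neutral n'"
  shows "\<exists>n. whn G k T n \<and> neutral n \<and> G \<turnstile> n \<^bold>= n' \<^bold>: Sort (Set k) \<and> R = (\<lambda>t t'. G \<turnstile> t \<^bold>= t' \<^bold>: T)"
  using assms(1) by (cases rule: LR.cases) (use assms(3) in \<open>auto dest: whn_unique[OF _ assms(2)]\<close>)

lemma LR_pi_left:
  assumes "LR G S k T T' R" "T \<leadsto>* Fun a s s' U V"
  obtains i j U' V' P Q where "s = Set i" "s' = Set j" "k = max i j"
    "whn G k T (Fun a (Set i) (Set j) U V)" "whn G k T' (Fun a (Set i) (Set j) U' V')"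
    "G \<turnstile> U \<^bold>= U' \<^bold>: Sort (Set i)" "(a, U) # G \<turnstile> V \<^bold>= V' \<^bold>: Sort (Set j)" "LR G S i U U' P"
    "\<And>u u'. rel_arg G a U P u u' \<Longrightarrow> LR G S j (subst 0 u V) (subst 0 u' V') (Q u)"
    "R = fun_rel G a i j U V P Q"
  using assms(1)
proof (cases rule: LR.cases)
  case (LR_pi a2 i j U2 V2 U' V' P Q)
  have e: "a2 = a" "s = Set i" "s' = Set j" "U2 = U" "V2 = V"
    using whn_unique[OF LR_pi(1) assms(2)] by simp_all
  note f = LR_pi[unfolded e(1,4,5)]
  show ?thesis by (rule that[OF e(2,3) f(3,1,2,4,5,6)], erule f(7), rule f(8))
qed (auto dest: whn_unique[OF _ assms(2)])

lemma LR_pi_right: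
  assumes "LR G S k T T' R" "T' \<leadsto>* Fun a s s' U' V'"
  obtains i j U V P Q where "s = Set i" "s' = Set j" "k = max i j"
    "whn G k T (Fun a (Set i) (Set j) U V)" "whn G k T' (Fun a (Set i) (Set j) U' V')"
    "G \<turnstile> U \<^bold>= U' \<^bold>: Sort (Set i)" "(a, U) # G \<turnstile> V \<^bold>= V' \<^bold>: Sort (Set j)" "LR G S i U U' P"
    "\<And>u u'. rel_arg G a U P u u' \<Longrightarrow> LR G S j (subst 0 u V) (subst 0 u' V') (Q u)"
    "R = fun_rel G a i j U V P Q"
  using assms(1)
proof (cases rule: LR.cases)
  case (LR_pi a2 i j U V U2 V2 P Q)
  have e: "a2 = a" "s = Set i" "s' = Set j" "U2 = U'" "V2 = V'"
    using whn_unique[OF LR_pi(2) assms(2)] by simp_all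
  note f = LR_pi[unfolded e(1,4,5)]
  show ?thesis by (rule that[OF e(2,3) f(3,1,2,4,5,6)], erule f(7), rule f(8))
qed (auto dest: whn_unique[OF _ assms(2)])

lemma Rule_max: "k = max i j \<Longrightarrow> (Set i, Set j, Set k) \<in> Rule"
  by (auto simp: Rule_def)

lemma whn_eq: "whn G k T X \<Longrightarrow> whn G k T' X' \<Longrightarrow> G \<turnstile> X \<^bold>= X' \<^bold>: Sort (Set k) \<Longrightarrow> G \<turnstile> T \<^bold>= T' \<^bold>: Sort (Set k)"
  unfolding whn_def by (metis eq_sym eq_trans)

lemma LR_type_eq: assumes "LR G S k T T' R" shows "G \<turnstile> T \<^bold>= T' \<^bold>: Sort (Set k)"
  using assms
proof (cases rule: LR.cases)
  case (LR_sort j)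
  then show ?thesis unfolding whn_def by (metis eq_sym eq_trans)
next
  case LR_ne
  then show ?thesis using whn_eq by blast
next
  case (LR_pi a i j U V U' V' P Q)
  from whn_eq[OF LR_pi(1,2)] show ?thesis using eq_pi[OF LR_pi(4,5) Rule_max[OF LR_pi(3)]] by blast
qed

lemma LR_term_eq: assumes "LR G S k T T' R" "R t t'" shows "G \<turnstile> t \<^bold>= t' \<^bold>: T"
  using assms(1)
proof (cases rule: LR.cases)
  case (LR_sort j)
  then show ?thesis using assms(2) whn_conv[OF LR_sort(1)] by simp
next
  case LR_ne
  then show ?thesis using assms(2) by simp
next
  case (LR_pi a i j U V U' V' P Q)
  then show ?thesis using assms(2) whn_conv[OF LR_pi(1)] by (simp add: fun_rel_def)
qed

lemma rel_arg_conv: "G \<turnstile> U \<^bold>= U' \<^bold>: Sort s \<Longrightarrow> rel_arg G a U P = rel_arg G a U' P"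
  using ty_conv_iff[OF resurrect_mono(3)]
  by (intro ext) (auto simp: rel_arg_def split: annot.split)

lemma fun_rel_cong:
  assumes "\<And>f f'. G \<turnstile> f \<^bold>= f' \<^bold>: Fun a (Set i) (Set j) U V \<longleftrightarrow> G \<turnstile> f \<^bold>= f' \<^bold>: Fun a (Set i) (Set j) U' V'"
    and "rel_arg G a U P = rel_arg G a U' P'"
    and "\<And>u u'. rel_arg G a U P u u' \<Longrightarrow> Q u = Q' u"
  shows "fun_rel G a i j U V P Q = fun_rel G a i j U' V' P' Q'"
  using assms unfolding fun_rel_def by (intro ext) metis

text \<open>The function part of the induction-recursion: the left type alone determines the term
  relation, whatever the level and the partner. For function types the families agree on related
  arguments, and these are the ones that \<open>fun_rel\<close> looks at.\<close>

lemma LR_functional_left: "LR G S k T T' R \<Longrightarrow> LR G S k' T T'' R' \<Longrightarrow> R = R'"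
proof (induction arbitrary: k' T'' R' rule: LR.induct)
  case (LR_sort k T j T' R)
  from LR_sort_left[OF LR_sort.prems whn_steps[OF LR_sort.hyps(1)]] show ?case
    using LR_sort.hyps by simp
next
  case (LR_ne k T n T' n' R)
  from LR_ne_left[OF LR_ne.prems whn_steps[OF LR_ne.hyps(1)] LR_ne.hyps(3)] show ?case
    using LR_ne.hyps(6) by blast
next
  case (LR_pi k T a i j U V T' U' V' P Q R)
  from LR_pi.hyps(1) have "T \<leadsto>* Fun a (Set i) (Set j) U V" by (simp add: whn_def)
  from LR_pi.prems this show ?case
  proof (rule LR_pi_left)
    fix i2 j2 U2 V2 P2 Q2
    assume ij: "Set i = Set i2" "Set j = Set j2" and U2: "LR G S i2 U U2 P2"
      and V2: "\<And>u u'. rel_arg G a U P2 u u' \<Longrightarrow> LR G S j2 (subst 0 u V) (subst 0 u' V2) (Q2 u)"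
      and R': "R' = fun_rel G a i2 j2 U V P2 Q2"
    have P: "P = P2" using LR_pi.IH(1) U2 by blast
    have "Q u = Q2 u" if "rel_arg G a U P u u'" for u u'
      using LR_pi.IH(2)[OF that V2] that P by simp
    then show "R = R'" unfolding LR_pi.hyps R' using ij P by (auto intro: fun_rel_cong)
  qed
qed

text \<open>Symmetry cannot reduce this to the left version, as its proof uses this lemma. The
  clauses express the relation through the left type, so the two left types have to be linked by
  judgemental equality through their common right type.\<close>

lemma LR_functional_right: "LR G S k T T' R \<Longrightarrow> LR G S k' T'' T' R' \<Longrightarrow> R = R'"
proof (induction arbitrary: k' T'' R' rule: LR.induct)
  case (LR_sort k T j T' R)
  from LR_sort_right[OF LR_sort.prems whn_steps[OF LR_sort.hyps(2)]] show ?case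
    using LR_sort.hyps by simp
next
  case (LR_ne k T n T' n' R)
  note T = whn_eq[OF LR_ne.hyps(1,2,5)]
  from LR_ne_right[OF LR_ne.prems whn_steps[OF LR_ne.hyps(2)] LR_ne.hyps(4)]
  have "R' = (\<lambda>t t'. G \<turnstile> t \<^bold>= t' \<^bold>: T'')" by blast
  with LR_ne.hyps show ?case
    using eq_conv_iff[OF T] eq_conv_iff[OF LR_type_eq[OF LR_ne.prems]] by (intro ext) simp
next
  case (LR_pi k T a i j U V T' U' V' P Q R)
  from LR_pi.hyps(2) have "T' \<leadsto>* Fun a (Set i) (Set j) U' V'" by (simp add: whn_def)
  from LR_pi.prems this show ?case
  proof (rule LR_pi_right)
    fix i2 j2 U2 V2 P2 Q2
    assume ij: "Set i = Set i2" "Set j = Set j2" and U2: "LR G S i2 U2 U' P2"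
      and eq: "G \<turnstile> U2 \<^bold>= U' \<^bold>: Sort (Set i2)" "(a, U2) # G \<turnstile> V2 \<^bold>= V' \<^bold>: Sort (Set j2)"
      and V2: "\<And>u u'. rel_arg G a U2 P2 u u' \<Longrightarrow> LR G S j2 (subst 0 u V2) (subst 0 u' V') (Q2 u)"
      and R': "R' = fun_rel G a i2 j2 U2 V2 P2 Q2"
    have P: "P = P2" using LR_pi.IH(1) U2 by blast
    have arg: "rel_arg G a U P = rel_arg G a U2 P2"
      using P rel_arg_conv[OF eq(1)] rel_arg_conv[OF LR_pi.hyps(4)] by simp
    have Q: "Q u = Q2 u" if "rel_arg G a U P u u'" for u u'
      using LR_pi.IH(2)[OF that V2] that arg by simp
    have "G \<turnstile> f \<^bold>= f' \<^bold>: Fun a (Set i) (Set j) U V \<longleftrightarrow> G \<turnstile> f \<^bold>= f' \<^bold>: Fun a (Set i) (Set j) U2 V2" for f f'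
      using eq_conv_iff[OF eq_pi[OF LR_pi.hyps(4,5) Rule_max[OF refl]]]
        eq_conv_iff[OF eq_pi[OF eq Rule_max[OF refl]]] ij by simp
    then show "R = R'" unfolding LR_pi.hyps R' using ij arg Q by (auto intro: fun_rel_cong)
  qed
qed

section \<open>Symmetry and transitivity of the relation\<close>

definition per :: "(tm \<Rightarrow> tm \<Rightarrow> bool) \<Rightarrow> bool" where
  "per P \<longleftrightarrow> (\<forall>x y. P x y \<longrightarrow> P y x) \<and> (\<forall>x y z. P x y \<longrightarrow> P y z \<longrightarrow> P x z)"

lemma perD: "per P \<Longrightarrow> P x y \<Longrightarrow> P y x" "per P \<Longrightarrow> P x y \<Longrightarrow> P y z \<Longrightarrow> P x z"
  unfolding per_def by blast+

lemma per_typed: "per (\<lambda>t t'. G \<turnstile> t \<^bold>= t' \<^bold>: T)"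
  unfolding per_def using eq_sym eq_trans by blast

lemma per_rel_arg: assumes "per P" shows "per (rel_arg G a U P)"
proof (cases a)
  case Rel
  then have "rel_arg G a U P = P" by (intro ext) (simp add: rel_arg_def)
  with assms show ?thesis by simp
next
  case Irr
  then show ?thesis by (simp add: per_def rel_arg_def)
qed

lemma rel_arg_refl:
  assumes "per P" "rel_arg G a U P u u'" shows "rel_arg G a U P u' u" "rel_arg G a U P u u" "rel_arg G a U P u' u'"
  using perD[OF per_rel_arg[OF assms(1)]] assms(2) by blast+

text \<open>Both claims go through one induction: reversing a pair of function types reverses
  related arguments, for which the domain relation must already be symmetric.\<close>

lemma LR_sym_per:
  assumes S: "\<And>j. per (S j)"
  shows "LR G S k T T' R \<Longrightarrow> LR G S k T' T R \<and> per R"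
proof (induction rule: LR.induct)
  case (LR_sort k T j T' R)
  have "per R" unfolding LR_sort(4) using perD[OF S[of j]] eq_sym eq_trans unfolding per_def by blast
  with LR.LR_sort[where S = S, OF LR_sort(2,1,3,4)] show ?case ..
next
  case (LR_ne k T n T' n' R)
  note T = whn_eq[OF LR_ne(1,2,5)]
  have "R = (\<lambda>t t'. G \<turnstile> t \<^bold>= t' \<^bold>: T')" unfolding LR_ne(6) using eq_conv_iff[OF T] by blast
  from LR.LR_ne[OF LR_ne(2,1,4,3) eq_sym[OF LR_ne(5)] this] per_typed LR_ne(6) show ?case by blast
next
  case (LR_pi k T a i j U V T' U' V' P Q R)
  have P: "per P" using LR_pi.IH(1) by blast
  note arg_refl = rel_arg_refl[OF P]
  have arg: "rel_arg G a U P = rel_arg G a U' P" using rel_arg_conv[OF LR_pi.hyps(4)] .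
  \<comment> \<open>The relations \<open>Q u\<close> and \<open>Q u'\<close> belong to pairs with
    the same right-hand type \<open>subst 0 u' V'\<close>.\<close>
  have Q: "Q u' = Q u" if "rel_arg G a U P u u'" for u u'
    using LR_functional_right LR_pi.hyps(7)[OF that] LR_pi.hyps(7)[OF arg_refl(3)[OF that]] by blast
  have typed: "G \<turnstile> f \<^bold>= f' \<^bold>: Fun a (Set i) (Set j) U V \<longleftrightarrow> G \<turnstile> f \<^bold>= f' \<^bold>: Fun a (Set i) (Set j) U' V'" for f f'
    using eq_conv_iff[OF eq_pi[OF LR_pi.hyps(4,5) Rule_max[OF refl]]] by simp
  have "(a, U') # G \<turnstile> V' \<^bold>= V \<^bold>: Sort (Set j)"
    using ctx_conv(2)[OF LR_pi.hyps(4)] validity(3)[OF LR_pi.hyps(4)] eq_sym[OF LR_pi.hyps(5)] by blast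
  moreover have "LR G S j (subst 0 u V') (subst 0 u' V) (Q u)" if "rel_arg G a U' P u u'" for u u'
  proof -
    have u: "rel_arg G a U P u u'" using that arg by simp
    show ?thesis using LR_pi.IH(2)[OF arg_refl(1)[OF u]] Q[OF u] by simp
  qed
  ultimately have "LR G S k T' T R"
    using LR.LR_pi[OF LR_pi.hyps(2,1,3) eq_sym[OF LR_pi.hyps(4)] _ conjunct1[OF LR_pi.IH(1)]]
      fun_rel_cong[OF typed arg, of Q Q] LR_pi.hyps(8) by simp
  moreover have "per R"
  proof -
    have sym: "R f' f" if R: "R f f'" for f f'
      unfolding LR_pi.hyps(8) fun_rel_def
    proof (intro conjI allI impI)
      show "G \<turnstile> f' \<^bold>= f \<^bold>: Fun a (Set i) (Set j) U V" using R eq_sym by (auto simp: LR_pi.hyps(8) fun_rel_def)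
      fix u u' assume u: "rel_arg G a U P u u'"
      have "Q u' (App a f u') (App a f' u)" using R arg_refl(1)[OF u] by (auto simp: LR_pi.hyps(8) fun_rel_def)
      then show "Q u (App a f' u) (App a f u')" using Q[OF u] perD(1) LR_pi.IH(2)[OF u] by metis
    qed
    have trans: "R f f''" if R: "R f f'" "R f' f''" for f f' f''
      unfolding LR_pi.hyps(8) fun_rel_def
    proof (intro conjI allI impI)
      show "G \<turnstile> f \<^bold>= f'' \<^bold>: Fun a (Set i) (Set j) U V"
        using R eq_trans by (auto simp: LR_pi.hyps(8) fun_rel_def)
      fix u u' assume u: "rel_arg G a U P u u'"
      have "Q u (App a f u) (App a f' u)" "Q u (App a f' u) (App a f'' u')"
        using R u arg_refl(2)[OF u] by (auto simp: LR_pi.hyps(8) fun_rel_def)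
      then show "Q u (App a f u) (App a f'' u')" using perD(2) LR_pi.IH(2)[OF u] by metis
    qed
    show ?thesis using sym trans unfolding per_def by blast
  qed
  ultimately show ?case ..
qed

lemma LR_trans:
  assumes S: "\<And>j. per (S j)"
  shows "LR G S k T T' R \<Longrightarrow> LR G S k T' T'' R' \<Longrightarrow> LR G S k T T'' R"
proof (induction arbitrary: T'' R' rule: LR.induct)
  case (LR_sort k T j T' R)
  have "whn G k T'' (Sort (Set j))"
    using LR_sort_left[OF LR_sort.prems whn_steps[OF LR_sort.hyps(2)]] by blast
  from LR.LR_sort[where S = S, OF LR_sort.hyps(1) this LR_sort.hyps(3,4)] show ?case .
next
  case (LR_ne k T n T' n' R)
  obtain n'' where n'': "whn G k T'' n''" "neutral n''" "G \<turnstile> n' \<^bold>= n'' \<^bold>: Sort (Set k)"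
    using LR_ne_left[OF LR_ne.prems whn_steps[OF LR_ne.hyps(2)] LR_ne.hyps(4)] by blast
  from LR.LR_ne[OF LR_ne.hyps(1) n''(1) LR_ne.hyps(3) n''(2) eq_trans[OF LR_ne.hyps(5) n''(3)] LR_ne.hyps(6)]
  show ?case .
next
  case (LR_pi k T a i j U V T' U' V' P Q R)
  have P: "per P" "LR G S i U' U P" using LR_sym_per[where S = S, OF S LR_pi.hyps(6)] by blast+
  from LR_pi.hyps(2) have "T' \<leadsto>* Fun a (Set i) (Set j) U' V'" by (simp add: whn_def)
  from LR_pi.prems this show ?case
  proof (rule LR_pi_left)
    fix i2 j2 U2 V2 P2 Q2
    assume ij: "Set i = Set i2" "Set j = Set j2" and U2: "LR G S i2 U' U2 P2"
      and T'': "whn G k T'' (Fun a (Set i2) (Set j2) U2 V2)"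
      and eq: "G \<turnstile> U' \<^bold>= U2 \<^bold>: Sort (Set i2)" "(a, U') # G \<turnstile> V' \<^bold>= V2 \<^bold>: Sort (Set j2)"
      and V2: "\<And>u u'. rel_arg G a U' P2 u u' \<Longrightarrow> LR G S j2 (subst 0 u V') (subst 0 u' V2) (Q2 u)"
    have P2: "P2 = P" using LR_functional_left U2 P(2) by blast
    have arg: "rel_arg G a U P = rel_arg G a U' P" using rel_arg_conv[OF LR_pi.hyps(4)] .
    have "(a, U) # G \<turnstile> V' \<^bold>= V2 \<^bold>: Sort (Set j)"
      using ctx_conv(2)[OF eq_sym[OF LR_pi.hyps(4)]] validity(3)[OF LR_pi.hyps(4)] eq ij by blast
    then have V: "(a, U) # G \<turnstile> V \<^bold>= V2 \<^bold>: Sort (Set j)" by (rule eq_trans[OF LR_pi.hyps(5)])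
    have U: "G \<turnstile> U \<^bold>= U2 \<^bold>: Sort (Set i)" using eq_trans[OF LR_pi.hyps(4)] eq ij by blast
    have LRU: "LR G S i U U2 P" using LR_pi.IH(1) U2 ij by blast
    \<comment> \<open>The two pairs are composed at \<open>subst 0 u V'\<close>: the diagonal of
      \<open>u\<close> comes first, and the second pair moves from \<open>u\<close> to
      \<open>u'\<close>.\<close>
    have Q: "LR G S j (subst 0 u V) (subst 0 u' V2) (Q u)" if "rel_arg G a U P u u'" for u u'
      using LR_pi.IH(2)[OF rel_arg_refl(2)[OF P(1) that]] V2[of u u'] that arg ij P2 by simp
    have "whn G k T'' (Fun a (Set i) (Set j) U2 V2)" using T'' ij by simp
    from LR.LR_pi[OF LR_pi.hyps(1) this LR_pi.hyps(3) U V LRU Q LR_pi.hyps(8)] show "LR G S k T T'' R" .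
  qed
qed

lemma LR_expand_type:
  assumes "LR G S k T T' R" and T0: "T0 \<leadsto>* T" "G \<turnstile> T0 \<^bold>= T \<^bold>: Sort (Set k)"
  shows "LR G S k T0 T' R"
proof -
  have whn: "whn G k T X \<Longrightarrow> whn G k T0 X" for X
    unfolding whn_def using T0(1) eq_trans[OF T0(2)] by auto
  from assms(1) show ?thesis
  proof (cases rule: LR.cases)
    case LR_sort
    show ?thesis by (rule LR.LR_sort[where S = S, OF whn[OF LR_sort(1)] LR_sort(2-4)])
  next
    case (LR_ne n n')
    then have "R = (\<lambda>t t'. G \<turnstile> t \<^bold>= t' \<^bold>: T0)" using eq_conv_iff[OF T0(2)] by simp
    from LR.LR_ne[OF whn[OF LR_ne(1)] LR_ne(2-5) this] show ?thesis .
  next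
    case LR_pi
    show ?thesis by (rule LR.LR_pi[OF whn[OF LR_pi(1)] LR_pi(2-8)])
  qed
qed

section \<open>The hierarchy of universes, reflection and head expansion\<close>

function univ :: "ctx \<Rightarrow> nat \<Rightarrow> tm \<Rightarrow> tm \<Rightarrow> bool" where
  "univ G j = (\<lambda>t t'. \<exists>R. LR G (\<lambda>i. if i < j then univ G i else (\<lambda>_ _. False)) j t t' R)"
  by pat_completeness auto
termination by (relation "measure snd") auto

declare univ.simps [simp del]

text \<open>The guard in \<open>univ\<close> makes the recursion on the level terminate; by
  \<open>LR_cong\<close> the guarded family and \<open>univ G\<close> give the same relation at
  level \<open>j\<close>.\<close>

lemma univ_iff: "univ G j t t' \<longleftrightarrow> (\<exists>R. LR G (univ G) j t t' R)"
proof -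
  have "LR G (\<lambda>i. if i < j then univ G i else (\<lambda>_ _. False)) j t t' R \<longleftrightarrow> LR G (univ G) j t t' R" for R
    by (auto elim: LR_cong)
  then show ?thesis unfolding univ.simps[of G j] by blast
qed

lemma per_univ: "per (univ G j)"
proof (induction j rule: less_induct)
  case (less j)
  have "per (\<lambda>_ _. False)" by (simp add: per_def)
  then have S: "per (if i < j then univ G i else (\<lambda>_ _. False))" for i
    using less by (cases "i < j") simp_all
  let ?S = "\<lambda>i. if i < j then univ G i else (\<lambda>_ _. False)"
  have "\<exists>R. LR G ?S j y x R" if "LR G ?S j x y R" for x y R
    using LR_sym_per[OF S that] by blast
  moreover have "\<exists>R. LR G ?S j x z R" if "LR G ?S j x y R" "LR G ?S j y z R'" for x y z R R'
    using LR_trans[OF S that] by blast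
  ultimately show ?case unfolding per_def univ.simps[of G j] by blast
qed

lemma rel_arg_eq:
  assumes "LR G S i U U' P" "rel_arg G a U P u u'"
  shows "arg_eq a G u u' U"
proof (cases a)
  case Rel
  then have "G \<turnstile> u \<^bold>= u' \<^bold>: U" using assms(2) LR_term_eq[OF assms(1)] by (simp add: rel_arg_def)
  with validity(3)[OF this] show ?thesis by (simp add: arg_eq_def Rel)
next
  case Irr
  then show ?thesis using assms(2) by (simp add: rel_arg_def arg_eq_def)
qed

text \<open>One half of the usual reify/reflect pair; the other half is \<open>LR_term_eq\<close>, a
  mere case analysis because every clause stores a typed equation. At a function type a neutral term
  applied to any argument is again neutral; at a sort it is a neutral type.\<close>

lemma reflect:
  "LR G (univ G) k T T' R \<Longrightarrow> neutral n \<Longrightarrow> neutral n' \<Longrightarrow> G \<turnstile> n \<^bold>= n' \<^bold>: T \<Longrightarrow> R n n'"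
proof (induction arbitrary: n n' rule: LR.induct)
  case (LR_sort k T j T' R)
  then have eq: "G \<turnstile> n \<^bold>= n' \<^bold>: Sort (Set j)" using whn_conv by blast
  then have "G \<turnstile> n \<^bold>= n \<^bold>: Sort (Set j)" "G \<turnstile> n' \<^bold>= n' \<^bold>: Sort (Set j)" using validity(3) eq_refl by blast+
  then have "LR G (univ G) j n n' (\<lambda>t t'. G \<turnstile> t \<^bold>= t' \<^bold>: n)"
    using LR_sort.prems eq by (intro LR.LR_ne[of G j n n n' n']) (auto simp: whn_def)
  then show ?case using eq LR_sort.hyps univ_iff by auto
next
  case LR_ne
  then show ?case by simp
next
  case (LR_pi k T a i j U V T' U' V' P Q R)
  have eq: "G \<turnstile> n \<^bold>= n' \<^bold>: Fun a (Set i) (Set j) U V"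
    using whn_conv[OF LR_pi.hyps(1)] LR_pi.prems by blast
  have "Q u (App a n u) (App a n' u')" if u: "rel_arg G a U P u u'" for u u'
    using LR_pi.IH(2)[OF u] LR_pi.prems eq_app[OF eq rel_arg_eq[OF LR_pi.hyps(6) u]] by simp
  with eq show ?case unfolding LR_pi.hyps(8) fun_rel_def by blast
qed

text \<open>Weak head reduction acts on the head of an application, so an expansion at a function
  type becomes an expansion of every application at the codomain.\<close>

lemma expand:
  "LR G (univ G) k T T' R \<Longrightarrow> R t t' \<Longrightarrow> s \<leadsto>* t \<Longrightarrow> G \<turnstile> s \<^bold>= t \<^bold>: T \<Longrightarrow> R s t'"
proof (induction arbitrary: s t t' rule: LR.induct)
  case (LR_sort k T j T' R)
  then have eq: "G \<turnstile> s \<^bold>= t \<^bold>: Sort (Set j)" using whn_conv by blast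
  obtain R' where "LR G (univ G) j t t' R'" using LR_sort.prems LR_sort.hyps univ_iff by auto
  from LR_expand_type[OF this \<open>s \<leadsto>* t\<close> eq] show ?case
    using LR_sort.prems LR_sort.hyps eq_trans[OF eq] univ_iff by auto
next
  case LR_ne
  then show ?case using eq_trans by metis
next
  case (LR_pi k T a i j U V T' U' V' P Q R)
  have eq: "G \<turnstile> s \<^bold>= t \<^bold>: Fun a (Set i) (Set j) U V"
    using whn_conv[OF LR_pi.hyps(1)] LR_pi.prems by blast
  have R: "G \<turnstile> t \<^bold>= t' \<^bold>: Fun a (Set i) (Set j) U V"
    "\<And>u u'. rel_arg G a U P u u' \<Longrightarrow> Q u (App a t u) (App a t' u')"
    using LR_pi.prems(1) unfolding LR_pi.hyps(8) fun_rel_def by blast+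
  have P: "per P" using LR_sym_per[OF per_univ LR_pi.hyps(6)] by blast
  have "Q u (App a s u) (App a t' u')" if u: "rel_arg G a U P u u'" for u u'
    using LR_pi.IH(2)[OF u R(2)[OF u] wsteps_app[OF \<open>s \<leadsto>* t\<close>]]
      eq_app[OF eq rel_arg_eq[OF LR_pi.hyps(6) rel_arg_refl(2)[OF P u]]] by blast
  with eq R(1) eq_trans show ?case unfolding LR_pi.hyps(8) fun_rel_def by blast
qed


section \<open>Semantic equality with hidden level and relation\<close>

lemmas univ_sym = perD(1)[OF per_univ]
lemmas univ_trans = perD(2)[OF per_univ]

lemma univI: "LR G (univ G) k T T' R \<Longrightarrow> univ G k T T'"
  using univ_iff by blast

lemma univE: assumes "univ G k T T'" obtains R where "LR G (univ G) k T T' R"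
  using assms univ_iff by blast

lemma univ_eq: "univ G k T T' \<Longrightarrow> G \<turnstile> T \<^bold>= T' \<^bold>: Sort (Set k)"
  by (erule univE) (rule LR_type_eq)

definition tm_rel :: "ctx \<Rightarrow> tm \<Rightarrow> tm \<Rightarrow> tm \<Rightarrow> tm \<Rightarrow> bool" where
  "tm_rel G T T' t t' \<longleftrightarrow> (\<exists>k R. LR G (univ G) k T T' R \<and> R t t')"

lemma tm_relE:
  assumes "tm_rel G T T' t t'"
  obtains k R where "LR G (univ G) k T T' R" "R t t'" "LR G (univ G) k T' T R" "per R"
  using assms LR_sym_per[where S = "univ G", OF per_univ] unfolding tm_rel_def by metis

lemma tm_rel_sym: assumes "tm_rel G T T' t t'" shows "tm_rel G T' T t' t"
  using assms
proof (rule tm_relE)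
  fix k R assume "LR G (univ G) k T' T R" "per R" "R t t'"
  then show ?thesis using perD(1) unfolding tm_rel_def by blast
qed

lemma tm_rel_eq: "tm_rel G T T' t t' \<Longrightarrow> G \<turnstile> t \<^bold>= t' \<^bold>: T"
  unfolding tm_rel_def using LR_term_eq by blast

text \<open>The terms need no transport: uniqueness at the shared types \<open>T\<close> and
  \<open>T1\<close> shows that all three relations are the same, even if \<open>t\<close> was
  related at another level.\<close>

lemma tm_rel_conv:
  assumes t: "tm_rel G T T' t t'" and T1: "univ G k T T1" and T2: "univ G k T1 T2"
  shows "tm_rel G T1 T2 t t'"
proof -
  obtain k0 R where R: "LR G (univ G) k0 T T' R" "R t t'" using t unfolding tm_rel_def by blast
  obtain R1 where R1: "LR G (univ G) k T T1 R1" using T1 by (rule univE)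
  obtain R2 where R2: "LR G (univ G) k T1 T2 R2" using T2 by (rule univE)
  have "R1 = R" by (rule LR_functional_left[OF R1 R(1)])
  moreover have "LR G (univ G) k T1 T R1" using LR_sym_per[where S = "univ G", OF per_univ R1] by blast
  then have "R1 = R2" using LR_functional_left R2 by blast
  ultimately show ?thesis using R R2 unfolding tm_rel_def by blast
qed

lemma tm_rel_level:
  assumes "tm_rel G T T' t t'" obtains k where "univ G k T T'"
  using assms univI unfolding tm_rel_def by blast

lemma tm_rel_refl_left: assumes "tm_rel G T T' t t'" shows "tm_rel G T T t t"
proof -
  obtain k R where R: "LR G (univ G) k T T' R" "R t t'" "LR G (univ G) k T' T R" "per R"
    using assms by (rule tm_relE)
  have "LR G (univ G) k T T R" using LR_trans[where S = "univ G", OF per_univ R(1,3)] .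
  moreover have "R t t" using perD[OF R(4)] R(2) by blast
  ultimately show ?thesis unfolding tm_rel_def by blast
qed

lemma tm_rel_trans:
  assumes "tm_rel G T T' t t'" "tm_rel G T' T'' t' t''"
  shows "tm_rel G T T' t t''"
proof -
  obtain k R where R: "LR G (univ G) k T T' R" "R t t'" "LR G (univ G) k T' T R" "per R"
    using assms(1) by (rule tm_relE)
  obtain k2 R2 where R2: "LR G (univ G) k2 T' T'' R2" "R2 t' t''"
    using assms(2) unfolding tm_rel_def by blast
  have "R2 = R" by (rule LR_functional_left[OF R2(1) R(3)])
  then show ?thesis using R R2 perD(2)[OF R(4)] unfolding tm_rel_def by blast
qed

lemma tm_rel_expand:
  assumes t: "tm_rel G T T' t t'" and s: "s \<leadsto>* t" "G \<turnstile> s \<^bold>= t \<^bold>: T"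
  shows "tm_rel G T T' s t'"
  using t expand[OF _ _ s] unfolding tm_rel_def by blast

lemma tm_rel_expand2:
  assumes "tm_rel G T T' t t'" "s \<leadsto>* t" "G \<turnstile> s \<^bold>= t \<^bold>: T" "s' \<leadsto>* t'" "G \<turnstile> s' \<^bold>= t' \<^bold>: T'"
  shows "tm_rel G T T' s s'"
  using tm_rel_sym[OF tm_rel_expand[OF tm_rel_sym[OF tm_rel_expand[OF assms(1-3)]] assms(4,5)]] .

lemma tm_rel_SortD:
  assumes "tm_rel G (Sort (Set j)) T' t t'" shows "univ G j t t'"
proof -
  obtain k R where R: "LR G (univ G) k (Sort (Set j)) T' R" "R t t'"
    using assms unfolding tm_rel_def by blast
  from LR_sort_left[OF R(1)] R(2) show ?thesis by auto
qed

lemma whn_refl: "G \<turnstile> T \<^bold>: Sort (Set k) \<Longrightarrow> whn G k T T"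
  unfolding whn_def using eq_refl by blast

lemma univ_Sort: assumes "\<turnstile> G" shows "univ G (Suc j) (Sort (Set j)) (Sort (Set j))"
proof -
  have "G \<turnstile> Sort (Set j) \<^bold>: Sort (Set (Suc j))" using assms by (intro ty_sort) (auto simp: Axiom_def)
  from LR_sort[where S = "univ G", OF whn_refl[OF this] whn_refl[OF this] refl refl]
  show ?thesis by (rule univI)
qed

lemma tm_rel_SortI:
  assumes "univ G j t t'" shows "tm_rel G (Sort (Set j)) (Sort (Set j)) t t'"
proof -
  have eq: "G \<turnstile> t \<^bold>= t' \<^bold>: Sort (Set j)" using univ_eq[OF assms] .
  then have "univ G (Suc j) (Sort (Set j)) (Sort (Set j))" using univ_Sort ctx_wf(3) by blast
  then obtain R where R: "LR G (univ G) (Suc j) (Sort (Set j)) (Sort (Set j)) R" by (rule univE)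
  from LR_sort_left[OF R rtranclp.rtrancl_refl] eq assms have "R t t'" by simp
  with R show ?thesis unfolding tm_rel_def by blast
qed

definition arg_rel :: "ctx \<Rightarrow> annot \<Rightarrow> tm \<Rightarrow> tm \<Rightarrow> tm \<Rightarrow> tm \<Rightarrow> bool" where
  "arg_rel G a U U' u u' = (case a of Rel \<Rightarrow> tm_rel G U U' u u'
     | Irr \<Rightarrow> resurrect G \<turnstile> u \<^bold>: U \<and> resurrect G \<turnstile> u' \<^bold>: U)"

lemma arg_rel_iff:
  assumes "LR G (univ G) i U U' P" shows "arg_rel G a U U' u u' \<longleftrightarrow> rel_arg G a U P u u'"
proof -
  have "tm_rel G U U' u u' \<longleftrightarrow> P u u'"
    using assms LR_functional_left unfolding tm_rel_def by blast
  then show ?thesis by (cases a) (simp_all add: arg_rel_def rel_arg_def)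
qed

section \<open>Semantic rules for function types\<close>

lemma univ_Fun:
  assumes U: "univ G i U U'" and V: "(a, U) # G \<turnstile> V \<^bold>= V' \<^bold>: Sort (Set j)"
    and UV: "\<And>u u'. arg_rel G a U U' u u' \<Longrightarrow> univ G j (subst 0 u V) (subst 0 u' V')"
  shows "univ G (max i j) (Fun a (Set i) (Set j) U V) (Fun a (Set i) (Set j) U' V')"
proof -
  obtain P where P: "LR G (univ G) i U U' P" using U by (rule univE)
  note eqU = univ_eq[OF U]
  \<comment> \<open>The hypothesis offers a relation for each pair \<open>u\<close>,
    \<open>u'\<close>, while \<open>LR_pi\<close> wants one depending on \<open>u\<close>. Any
    choice over all partners works, because the left type \<open>subst 0 u V\<close> determines the
    relation.\<close>
  define Q where "Q u = (SOME R. \<exists>u'. LR G (univ G) j (subst 0 u V) (subst 0 u' V') R)" for u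
  have Q: "LR G (univ G) j (subst 0 u V) (subst 0 u' V') (Q u)" if u: "rel_arg G a U P u u'" for u u'
  proof -
    obtain R where R: "LR G (univ G) j (subst 0 u V) (subst 0 u' V') R"
      using UV[unfolded arg_rel_iff[OF P], OF u] by (rule univE)
    then have "\<exists>u'. LR G (univ G) j (subst 0 u V) (subst 0 u' V') (Q u)"
      unfolding Q_def by (intro someI[of "\<lambda>R. \<exists>u'. LR G (univ G) j (subst 0 u V) (subst 0 u' V') R"]) blast
    then have "Q u = R" using LR_functional_left R by blast
    with R show ?thesis by simp
  qed
  have "G \<turnstile> Fun a (Set i) (Set j) U V \<^bold>= Fun a (Set i) (Set j) U' V' \<^bold>: Sort (Set (max i j))"
    by (rule eq_pi[OF eqU V Rule_max[OF refl]])
  then have F: "G \<turnstile> Fun a (Set i) (Set j) U V \<^bold>: Sort (Set (max i j))"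
    "G \<turnstile> Fun a (Set i) (Set j) U' V' \<^bold>: Sort (Set (max i j))" using validity(3) by blast+
  from LR_pi[OF whn_refl[OF F(1)] whn_refl[OF F(2)] refl eqU V P Q refl]
  show ?thesis by (rule univI)
qed

text \<open>Semantic injectivity: function types are weak head normal, so the components stored by
  \<open>LR_pi\<close> are the displayed ones. Besides the final theorem it serves application,
  where the codomain family is extracted from related function types.\<close>

lemma univ_FunD:
  assumes "univ G k (Fun a s s' U V) (Fun a' r r' U' V')"
  obtains i j where "a' = a" "s = Set i" "s' = Set j" "r = Set i" "r' = Set j" "k = max i j"
    "univ G i U U'" "(a, U) # G \<turnstile> V \<^bold>= V' \<^bold>: Sort (Set j)"
    "\<And>u u'. arg_rel G a U U' u u' \<Longrightarrow> univ G j (subst 0 u V) (subst 0 u' V')"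
proof -
  obtain R where R: "LR G (univ G) k (Fun a s s' U V) (Fun a' r r' U' V') R"
    using assms by (rule univE)
  from R rtranclp.rtrancl_refl show ?thesis
  proof (rule LR_pi_left)
    fix i j U2 V2 P Q
    assume e: "s = Set i" "s' = Set j" "k = max i j" and V: "(a, U) # G \<turnstile> V \<^bold>= V2 \<^bold>: Sort (Set j)"
      and whn2: "whn G k (Fun a' r r' U' V') (Fun a (Set i) (Set j) U2 V2)"
      and P: "LR G (univ G) i U U2 P"
      and Q: "\<And>u u'. rel_arg G a U P u u' \<Longrightarrow> LR G (univ G) j (subst 0 u V) (subst 0 u' V2) (Q u)"
    have e2: "a' = a" "r = Set i" "r' = Set j" "U2 = U'" "V2 = V'"
      using whn_unique[OF whn2 rtranclp.rtrancl_refl] by simp_all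
    show ?thesis
    proof (rule that[OF e2(1) e(1,2) e2(2,3) e(3)])
      show "univ G i U U'" using univI[OF P] unfolding e2 .
      show "(a, U) # G \<turnstile> V \<^bold>= V' \<^bold>: Sort (Set j)" using V unfolding e2 .
      fix u u' assume "arg_rel G a U U' u u'"
      then have "rel_arg G a U P u u'" using arg_rel_iff[OF P] unfolding e2 by blast
      from univI[OF Q[OF this]] show "univ G j (subst 0 u V) (subst 0 u' V')" unfolding e2 .
    qed
  qed
qed

lemma tm_rel_app:
  assumes f: "tm_rel G (Fun a s s' U V) (Fun a s s' U' V') f f'" and u: "arg_rel G a U U' u u'"
  shows "tm_rel G (subst 0 u V) (subst 0 u' V') (App a f u) (App a f' u')"
proof -
  obtain k R where R: "LR G (univ G) k (Fun a s s' U V) (Fun a s s' U' V') R" "R f f'"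
    using f unfolding tm_rel_def by blast
  from R(1) rtranclp.rtrancl_refl show ?thesis
  proof (rule LR_pi_left)
    fix i j U2 V2 P Q
    assume whn2: "whn G k (Fun a s s' U' V') (Fun a (Set i) (Set j) U2 V2)"
      and P: "LR G (univ G) i U U2 P"
      and Q: "\<And>u u'. rel_arg G a U P u u' \<Longrightarrow> LR G (univ G) j (subst 0 u V) (subst 0 u' V2) (Q u)"
      and RQ: "R = fun_rel G a i j U V P Q"
    have e2: "U2 = U'" "V2 = V'"
      using whn_unique[OF whn2 rtranclp.rtrancl_refl] by simp_all
    have u: "rel_arg G a U P u u'" using u arg_rel_iff[OF P] unfolding e2 by blast
    then have "Q u (App a f u) (App a f' u')" using R(2) unfolding RQ fun_rel_def by blast
    with Q[OF u] show ?thesis unfolding e2 tm_rel_def by blast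
  qed
qed

lemma tm_rel_FunI:
  assumes F: "univ G k (Fun a s s' U V) (Fun a s s' U' V')"
    and f: "G \<turnstile> f \<^bold>= f' \<^bold>: Fun a s s' U V"
    and app: "\<And>u u'. arg_rel G a U U' u u' \<Longrightarrow>
      tm_rel G (subst 0 u V) (subst 0 u' V') (App a f u) (App a f' u')"
  shows "tm_rel G (Fun a s s' U V) (Fun a s s' U' V') f f'"
proof -
  obtain R where R: "LR G (univ G) k (Fun a s s' U V) (Fun a s s' U' V') R"
    using F by (rule univE)
  from R rtranclp.rtrancl_refl show ?thesis
  proof (rule LR_pi_left)
    fix i j U2 V2 P Q
    assume e: "s = Set i" "s' = Set j"
      and whn2: "whn G k (Fun a s s' U' V') (Fun a (Set i) (Set j) U2 V2)"
      and P: "LR G (univ G) i U U2 P"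
      and Q: "\<And>u u'. rel_arg G a U P u u' \<Longrightarrow> LR G (univ G) j (subst 0 u V) (subst 0 u' V2) (Q u)"
      and RQ: "R = fun_rel G a i j U V P Q"
    have e2: "U2 = U'" "V2 = V'"
      using whn_unique[OF whn2 rtranclp.rtrancl_refl] by simp_all
    have "Q u (App a f u) (App a f' u')" if u: "rel_arg G a U P u u'" for u u'
    proof -
      have "arg_rel G a U U' u u'" using u arg_rel_iff[OF P] unfolding e2 by blast
      from app[OF this] obtain k' R' where "LR G (univ G) k' (subst 0 u V) (subst 0 u' V') R'"
        "R' (App a f u) (App a f' u')" unfolding tm_rel_def by blast
      with Q[OF u] LR_functional_left show ?thesis unfolding e2 by blast
    qed
    with f have "R f f'" unfolding RQ fun_rel_def e by blast
    with R show ?thesis unfolding tm_rel_def by blast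
  qed
qed


section \<open>The fundamental theorem\<close>

definition sub_rel :: "ctx \<Rightarrow> ctx \<Rightarrow> (nat \<Rightarrow> tm) \<Rightarrow> (nat \<Rightarrow> tm) \<Rightarrow> bool" where
  "sub_rel G \<Gamma> \<sigma> \<sigma>' \<longleftrightarrow> sub G \<Gamma> \<sigma> \<and> sub G \<Gamma> \<sigma>' \<and> (\<forall>i \<ge> length \<Gamma>. \<sigma> i = \<sigma>' i) \<and>
     (\<forall>i < length \<Gamma>. fst (\<Gamma> ! i) = Rel \<longrightarrow>
       tm_rel G (sb \<sigma> ((lift 0 ^^ Suc i) (snd (\<Gamma> ! i)))) (sb \<sigma>' ((lift 0 ^^ Suc i) (snd (\<Gamma> ! i)))) (\<sigma> i) (\<sigma>' i))"

lemma sub_rel_eqv: "sub_rel G \<Gamma> \<sigma> \<sigma>' \<Longrightarrow> sub_eqv G \<Gamma> \<sigma> \<sigma>'"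
  unfolding sub_rel_def sub_eqv_def using tm_rel_eq by blast

lemma sub_rel_sub: "sub_rel G \<Gamma> \<sigma> \<sigma>' \<Longrightarrow> sub G \<Gamma> \<sigma> \<and> sub G \<Gamma> \<sigma>' \<and> \<turnstile> G"
  unfolding sub_rel_def sub_def by blast

lemma sub_rel_sym: "sub_rel G \<Gamma> \<sigma> \<sigma>' \<Longrightarrow> sub_rel G \<Gamma> \<sigma>' \<sigma>"
  unfolding sub_rel_def using tm_rel_sym by metis

lemma sub_rel_refl_left: "sub_rel G \<Gamma> \<sigma> \<sigma>' \<Longrightarrow> sub_rel G \<Gamma> \<sigma> \<sigma>"
  unfolding sub_rel_def using tm_rel_refl_left by metis

lemma sub_rel_refl_right: "sub_rel G \<Gamma> \<sigma> \<sigma>' \<Longrightarrow> sub_rel G \<Gamma> \<sigma>' \<sigma>'"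
  using sub_rel_refl_left sub_rel_sym by blast

lemma arg_rel_typed:
  assumes u: "arg_rel G a U U' u u'" and U: "G \<turnstile> U \<^bold>= U' \<^bold>: Sort s"
  shows "ctx_for a G \<turnstile> u \<^bold>: U" "ctx_for a G \<turnstile> u' \<^bold>: U'"
proof -
  have "ctx_for a G \<turnstile> u \<^bold>: U \<and> ctx_for a G \<turnstile> u' \<^bold>: U'"
  proof (cases a)
    case Rel
    with u have "tm_rel G U U' u u'" by (simp add: arg_rel_def)
    then have "G \<turnstile> u \<^bold>= u' \<^bold>: U" "G \<turnstile> u' \<^bold>= u \<^bold>: U'" using tm_rel_eq tm_rel_sym by blast+
    then show ?thesis using validity(3) Rel by simp
  next
    case Irr
    with u ty_conv_iff[OF resurrect_mono(3)[OF U]] show ?thesis by (simp add: arg_rel_def)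
  qed
  then show "ctx_for a G \<turnstile> u \<^bold>: U" "ctx_for a G \<turnstile> u' \<^bold>: U'" by blast+
qed

lemma arg_rel_conv:
  assumes u: "arg_rel G a U U' u u'" and U: "univ G k U W" "univ G k W W'"
  shows "arg_rel G a W W' u u'"
proof (cases a)
  case Rel
  with tm_rel_conv[OF _ U] u show ?thesis by (simp add: arg_rel_def)
next
  case Irr
  with u ty_conv_iff[OF resurrect_mono(3)[OF univ_eq[OF U(1)]]] show ?thesis by (simp add: arg_rel_def)
qed

lemma sub_rel_scons:
  assumes \<sigma>: "sub_rel G \<Gamma> \<sigma> \<sigma>'" and U: "\<Gamma> \<turnstile> U \<^bold>: Sort s"
    and u: "arg_rel G a (sb \<sigma> U) (sb \<sigma>' U) u u'"
  shows "sub_rel G ((a, U) # \<Gamma>) (u \<cdot> \<sigma>) (u' \<cdot> \<sigma>')"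
proof -
  have "G \<turnstile> sb \<sigma> U \<^bold>= sb \<sigma>' U \<^bold>: Sort s" using functionality[OF sub_rel_eqv[OF \<sigma>] U] by simp
  note u' = arg_rel_typed[OF u this]
  have "sub G ((a, U) # \<Gamma>) (u \<cdot> \<sigma>)" "sub G ((a, U) # \<Gamma>) (u' \<cdot> \<sigma>')"
    using sub_scons u' sub_rel_sub[OF \<sigma>] by blast+
  moreover have "(u \<cdot> \<sigma>) i = (u' \<cdot> \<sigma>') i" if "i \<ge> length ((a, U) # \<Gamma>)" for i
    using that \<sigma> by (cases i) (auto simp: sub_rel_def)
  ultimately show ?thesis
    using \<sigma> u unfolding sub_rel_def by (auto simp: All_less_Suc2 arg_rel_def)
qed

text \<open>Validity of \<open>T\<close> is built in: \<open>tm_rel\<close> contains that the two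
  instances of \<open>T\<close> are related types. The source \<open>\<Gamma>\<close> and the fixed
  target \<open>G\<close> are linked by the substitutions alone.\<close>

definition valid :: "ctx \<Rightarrow> ctx \<Rightarrow> tm \<Rightarrow> tm \<Rightarrow> tm \<Rightarrow> bool" where
  "valid G \<Gamma> t t' T \<longleftrightarrow> (\<forall>\<sigma> \<sigma>'. sub_rel G \<Gamma> \<sigma> \<sigma>' \<longrightarrow> tm_rel G (sb \<sigma> T) (sb \<sigma>' T) (sb \<sigma> t) (sb \<sigma>' t'))"

lemma validI: "(\<And>\<sigma> \<sigma>'. sub_rel G \<Gamma> \<sigma> \<sigma>' \<Longrightarrow> tm_rel G (sb \<sigma> T) (sb \<sigma>' T) (sb \<sigma> t) (sb \<sigma>' t')) \<Longrightarrow> valid G \<Gamma> t t' T"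
  unfolding valid_def by blast

lemma validD: "valid G \<Gamma> t t' T \<Longrightarrow> sub_rel G \<Gamma> \<sigma> \<sigma>' \<Longrightarrow> tm_rel G (sb \<sigma> T) (sb \<sigma>' T) (sb \<sigma> t) (sb \<sigma>' t')"
  unfolding valid_def by blast

lemma valid_type:
  assumes "valid G \<Gamma> T T' (Sort (Set k))" "sub_rel G \<Gamma> \<sigma> \<sigma>'"
  shows "univ G k (sb \<sigma> T) (sb \<sigma>' T')"
  using tm_rel_SortD validD[OF assms] by simp

lemma valid_type_all:
  assumes T: "valid G \<Gamma> T T' (Sort (Set k))" and \<sigma>: "sub_rel G \<Gamma> \<sigma> \<sigma>'"
  shows "univ G k (sb \<sigma> T) (sb \<sigma>' T')" "univ G k (sb \<sigma> T) (sb \<sigma>' T)" "univ G k (sb \<sigma> T') (sb \<sigma>' T')"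
    "univ G k (sb \<sigma> T) (sb \<sigma> T')"
proof -
  note u = valid_type[OF T]
  show 1: "univ G k (sb \<sigma> T) (sb \<sigma>' T')" by (rule u[OF \<sigma>])
  show 2: "univ G k (sb \<sigma> T) (sb \<sigma> T')" by (rule u[OF sub_rel_refl_left[OF \<sigma>]])
  show "univ G k (sb \<sigma> T) (sb \<sigma>' T)"
    by (rule univ_trans[OF 1 univ_sym[OF u[OF sub_rel_refl_right[OF \<sigma>]]]])
  show "univ G k (sb \<sigma> T') (sb \<sigma>' T')" by (rule univ_trans[OF univ_sym[OF 2] 1])
qed

lemma valid_eq:
  assumes "\<Gamma> \<turnstile> t \<^bold>= t' \<^bold>: T" "sub_rel G \<Gamma> \<sigma> \<sigma>'"
  shows "G \<turnstile> sb \<sigma> t \<^bold>= sb \<sigma>' t' \<^bold>: sb \<sigma> T"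
  using functionality_eq[OF sub_rel_eqv[OF assms(2)] assms(1)] .

section \<open>Soundness of the individual rules\<close>

lemma valid_Fun:
  assumes U: "\<Gamma> \<turnstile> U \<^bold>= U' \<^bold>: Sort s1" "valid G \<Gamma> U U' (Sort s1)"
    and T: "(a, U) # \<Gamma> \<turnstile> T \<^bold>= T' \<^bold>: Sort s2" "valid G ((a, U) # \<Gamma>) T T' (Sort s2)"
    and rule: "(s1, s2, s3) \<in> Rule"
  shows "valid G \<Gamma> (Fun a s1 s2 U T) (Fun a s1 s2 U' T') (Sort s3)"
proof (rule validI)
  fix \<sigma> \<sigma>' assume \<sigma>: "sub_rel G \<Gamma> \<sigma> \<sigma>'"
  obtain i j where s: "s1 = Set i" "s2 = Set j" "s3 = Set (max i j)" using rule by (auto simp: Rule_def)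
  have U\<sigma>: "\<Gamma> \<turnstile> U \<^bold>: Sort s1" using validity(3)[OF U(1)] by blast
  note uU = valid_type_all[OF U(2)[unfolded s] \<sigma>]
  have "univ G (max i j) (Fun a (Set i) (Set j) (sb \<sigma> U) (sb (up \<sigma>) T))
      (Fun a (Set i) (Set j) (sb \<sigma>' U') (sb (up \<sigma>') T'))"
  proof (rule univ_Fun[OF uU(1)])
    \<comment> \<open>The bound variable lies outside \<open>G\<close>, where the semantic
      hypothesis for the codomains says nothing; the derivation itself is instantiated
      instead.\<close>
    show "(a, sb \<sigma> U) # G \<turnstile> sb (up \<sigma>) T \<^bold>= sb (up \<sigma>') T' \<^bold>: Sort (Set j)"
      using functionality_eq[OF sub_eqv_up[OF sub_rel_eqv[OF \<sigma>] U\<sigma>] T(1)] s by simp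
    fix u u' assume "arg_rel G a (sb \<sigma> U) (sb \<sigma>' U') u u'"
    then have "arg_rel G a (sb \<sigma> U) (sb \<sigma>' U) u u'"
      by (rule arg_rel_conv[OF _ _ uU(2)]) (rule univ_trans[OF uU(2) univ_sym[OF uU(2)]])
    from valid_type[OF T(2)[unfolded s] sub_rel_scons[OF \<sigma> U\<sigma> this]]
    show "univ G j (subst 0 u (sb (up \<sigma>) T)) (subst 0 u' (sb (up \<sigma>') T'))" by (simp add: subst0_up)
  qed
  from tm_rel_SortI[OF this] show "tm_rel G (sb \<sigma> (Sort s3)) (sb \<sigma>' (Sort s3))
      (sb \<sigma> (Fun a s1 s2 U T)) (sb \<sigma>' (Fun a s1 s2 U' T'))" by (simp add: s)
qed

lemma beta_sub:
  assumes t: "(a, U) # \<Gamma> \<turnstile> t \<^bold>: T" and \<sigma>: "sub G \<Gamma> \<sigma>" and u: "ctx_for a G \<turnstile> u \<^bold>: sb \<sigma> U"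
  shows "App a (sb \<sigma> (Lam a U t)) u \<leadsto>* sb (u \<cdot> \<sigma>) t"
    "G \<turnstile> App a (sb \<sigma> (Lam a U t)) u \<^bold>= sb (u \<cdot> \<sigma>) t \<^bold>: sb (u \<cdot> \<sigma>) T"
proof -
  show "App a (sb \<sigma> (Lam a U t)) u \<leadsto>* sb (u \<cdot> \<sigma>) t"
    using wbeta[of a "sb \<sigma> U" "sb (up \<sigma>) t" u] by (simp add: subst0_up)
  obtain s where U: "\<Gamma> \<turnstile> U \<^bold>: Sort s" using ctx_wf(2)[OF t] ctx_wf_tail by blast
  have "G \<turnstile> sb \<sigma> U \<^bold>: Sort s" using sub_ty[OF U \<sigma>] by simp
  from eq_beta[OF sub_ty[OF t sub.ext[OF \<sigma> this]] u]
  show "G \<turnstile> App a (sb \<sigma> (Lam a U t)) u \<^bold>= sb (u \<cdot> \<sigma>) t \<^bold>: sb (u \<cdot> \<sigma>) T" by (simp add: subst0_up)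
qed

lemma valid_Lam:
  assumes U: "\<Gamma> \<turnstile> U \<^bold>= U' \<^bold>: Sort s1" and F: "valid G \<Gamma> (Fun a s1 s2 U T) (Fun a s1 s2 U T) (Sort s3)"
    and eq: "\<Gamma> \<turnstile> Lam a U t \<^bold>= Lam a U' t' \<^bold>: Fun a s1 s2 U T"
    and t: "(a, U) # \<Gamma> \<turnstile> t \<^bold>= t' \<^bold>: T" "valid G ((a, U) # \<Gamma>) t t' T"
  shows "valid G \<Gamma> (Lam a U t) (Lam a U' t') (Fun a s1 s2 U T)"
proof (rule validI)
  fix \<sigma> \<sigma>' assume \<sigma>: "sub_rel G \<Gamma> \<sigma> \<sigma>'"
  have sub: "sub G \<Gamma> \<sigma>" "sub G \<Gamma> \<sigma>'" using sub_rel_sub[OF \<sigma>] by blast+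
  have U1: "\<Gamma> \<turnstile> U \<^bold>: Sort s1" "\<Gamma> \<turnstile> U' \<^bold>: Sort s1" using validity(3)[OF U] by blast+
  have t1: "(a, U) # \<Gamma> \<turnstile> t \<^bold>: T" "(a, U) # \<Gamma> \<turnstile> t' \<^bold>: T" using validity(3)[OF t(1)] by blast+
  have t2: "(a, U') # \<Gamma> \<turnstile> t' \<^bold>: T" by (rule ctx_conv(1)[OF U U1(2) t1(2)])
  obtain k where "s3 = Set k" by (cases s3)
  then have "univ G k (sb \<sigma> (Fun a s1 s2 U T)) (sb \<sigma>' (Fun a s1 s2 U T))"
    using valid_type F \<sigma> by blast
  then have uF: "univ G k (Fun a s1 s2 (sb \<sigma> U) (sb (up \<sigma>) T)) (Fun a s1 s2 (sb \<sigma>' U) (sb (up \<sigma>') T))" by simp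
  have "tm_rel G (Fun a s1 s2 (sb \<sigma> U) (sb (up \<sigma>) T)) (Fun a s1 s2 (sb \<sigma>' U) (sb (up \<sigma>') T))
      (sb \<sigma> (Lam a U t)) (sb \<sigma>' (Lam a U' t'))"
  proof (rule tm_rel_FunI[OF uF])
    show "G \<turnstile> sb \<sigma> (Lam a U t) \<^bold>= sb \<sigma>' (Lam a U' t') \<^bold>: Fun a s1 s2 (sb \<sigma> U) (sb (up \<sigma>) T)"
      using valid_eq[OF eq \<sigma>] by simp
    fix u u' assume u: "arg_rel G a (sb \<sigma> U) (sb \<sigma>' U) u u'"
    have eqU: "G \<turnstile> sb \<sigma> U \<^bold>= sb \<sigma>' U \<^bold>: Sort s1" using valid_eq[OF eq_refl[OF U1(1)] \<sigma>] by simp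
    have eqU': "G \<turnstile> sb \<sigma>' U \<^bold>= sb \<sigma>' U' \<^bold>: Sort s1" using sub_eq[OF U sub(2)] by simp
    note tu = arg_rel_typed[OF u eqU]
    \<comment> \<open>Beta on the right needs the argument at the annotation of the right-hand
      lambda.\<close>
    have u': "ctx_for a G \<turnstile> u' \<^bold>: sb \<sigma>' U'" by (rule ty_conv[OF tu(2) ctx_for_mono(3)[OF eqU']])
    show "tm_rel G (subst 0 u (sb (up \<sigma>) T)) (subst 0 u' (sb (up \<sigma>') T))
        (App a (sb \<sigma> (Lam a U t)) u) (App a (sb \<sigma>' (Lam a U' t')) u')"
      using tm_rel_expand2[OF validD[OF t(2) sub_rel_scons[OF \<sigma> U1(1) u]]
          beta_sub[OF t1(1) sub(1) tu(1)] beta_sub[OF t2 sub(2) u']] by (simp add: subst0_up)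
  qed
  then show "tm_rel G (sb \<sigma> (Fun a s1 s2 U T)) (sb \<sigma>' (Fun a s1 s2 U T)) (sb \<sigma> (Lam a U t)) (sb \<sigma>' (Lam a U' t'))"
    by simp
qed

lemma ctx_for_sub: "sub G \<Gamma> \<sigma> \<Longrightarrow> ctx_for a \<Gamma> \<turnstile> u \<^bold>: U \<Longrightarrow> ctx_for a G \<turnstile> sb \<sigma> u \<^bold>: sb \<sigma> U"
  using sub_ty sub.res_for by blast

text \<open>For an irrelevant argument a semantic hypothesis would concern the resurrected context,
  for which \<open>\<sigma>\<close> and \<open>\<sigma>'\<close> need not be related;
  \<open>arg_rel\<close> asks there for the typing of both instances, which substitution
  provides.\<close>

lemma valid_arg:
  assumes U: "\<Gamma> \<turnstile> U \<^bold>: Sort s" and u: "ctx_for a \<Gamma> \<turnstile> u \<^bold>: U" "ctx_for a \<Gamma> \<turnstile> u' \<^bold>: U"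
    and valid: "a = Rel \<Longrightarrow> valid G \<Gamma> u u' U" and \<sigma>: "sub_rel G \<Gamma> \<sigma> \<sigma>'"
  shows "arg_rel G a (sb \<sigma> U) (sb \<sigma>' U) (sb \<sigma> u) (sb \<sigma>' u')"
proof (cases a)
  case Rel
  with validD[OF valid \<sigma>] show ?thesis by (simp add: arg_rel_def)
next
  case Irr
  have "sub G \<Gamma> \<sigma>" "sub G \<Gamma> \<sigma>'" using sub_rel_sub[OF \<sigma>] by blast+
  from ctx_for_sub[OF this(1) u(1)] ctx_for_sub[OF this(2) u(2)]
  have "resurrect G \<turnstile> sb \<sigma> u \<^bold>: sb \<sigma> U" "resurrect G \<turnstile> sb \<sigma>' u' \<^bold>: sb \<sigma>' U" by (simp_all add: Irr)
  moreover have "G \<turnstile> sb \<sigma> U \<^bold>= sb \<sigma>' U \<^bold>: Sort s" using valid_eq[OF eq_refl[OF U] \<sigma>] by simp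
  ultimately show ?thesis using ty_conv_iff[OF resurrect_mono(3)] by (simp add: arg_rel_def Irr)
qed

lemma valid_left: assumes "valid G \<Gamma> t t' T" shows "valid G \<Gamma> t t T"
proof (rule validI)
  fix \<sigma> \<sigma>' assume "sub_rel G \<Gamma> \<sigma> \<sigma>'"
  from validD[OF assms this] tm_rel_sym[OF validD[OF assms sub_rel_refl_right[OF this]]]
  show "tm_rel G (sb \<sigma> T) (sb \<sigma>' T) (sb \<sigma> t) (sb \<sigma>' t)" by (rule tm_rel_trans)
qed

lemma valid_App:
  assumes f: "\<Gamma> \<turnstile> t \<^bold>: Fun a s s' U T" "valid G \<Gamma> t t' (Fun a s s' U T)"
    and u: "ctx_for a \<Gamma> \<turnstile> u \<^bold>: U" "ctx_for a \<Gamma> \<turnstile> u' \<^bold>: U"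
    and valid: "a = Rel \<Longrightarrow> valid G \<Gamma> u u' U"
  shows "valid G \<Gamma> (App a t u) (App a t' u') (subst 0 u T)"
proof (rule validI)
  fix \<sigma> \<sigma>' assume \<sigma>: "sub_rel G \<Gamma> \<sigma> \<sigma>'"
  obtain r where F: "\<Gamma> \<turnstile> Fun a s s' U T \<^bold>: Sort r" using validity(2)[OF f(1)] by blast
  note UT = typing_Fun_inv[OF F]
  from validD[OF f(2) \<sigma>] have ff': "tm_rel G (Fun a s s' (sb \<sigma> U) (sb (up \<sigma>) T))
      (Fun a s s' (sb \<sigma>' U) (sb (up \<sigma>') T)) (sb \<sigma> t) (sb \<sigma>' t')" by simp
  have uu': "arg_rel G a (sb \<sigma> U) (sb \<sigma>' U) (sb \<sigma> u) (sb \<sigma>' u')"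
    by (rule valid_arg[OF UT(1) u valid \<sigma>])
  \<comment> \<open>\<open>tm_rel_app\<close> yields the right-hand type at
    \<open>sb \<sigma>' u'\<close>, but the conclusion wants it at \<open>sb \<sigma>' u\<close>.
    Relating the two instances of \<open>u\<close> gives the conversion.\<close>
  have uu: "arg_rel G a (sb \<sigma> U) (sb \<sigma>' U) (sb \<sigma> u) (sb \<sigma>' u)"
    by (rule valid_arg[OF UT(1) u(1,1) valid_left[OF valid] \<sigma>])
  obtain k where "univ G k (Fun a s s' (sb \<sigma> U) (sb (up \<sigma>) T)) (Fun a s s' (sb \<sigma>' U) (sb (up \<sigma>') T))"
    using ff' by (rule tm_rel_level)
  then obtain j where T: "univ G j (subst 0 (sb \<sigma> u) (sb (up \<sigma>) T)) (subst 0 (sb \<sigma>' u) (sb (up \<sigma>') T))"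
    by (rule univ_FunD) (use uu in blast)
  from tm_rel_conv[OF tm_rel_app[OF ff' uu'] univ_trans[OF T univ_sym[OF T]] T]
  show "tm_rel G (sb \<sigma> (subst 0 u T)) (sb \<sigma>' (subst 0 u T)) (sb \<sigma> (App a t u)) (sb \<sigma>' (App a t' u'))"
    by (simp add: sb_subst0 subst0_up)
qed

lemma valid_conv:
  assumes t: "valid G \<Gamma> t t' T" and T: "valid G \<Gamma> T T' (Sort s)"
  shows "valid G \<Gamma> t t' T'"
proof (rule validI)
  fix \<sigma> \<sigma>' assume \<sigma>: "sub_rel G \<Gamma> \<sigma> \<sigma>'"
  obtain k where "s = Set k" by (cases s)
  note uT = valid_type_all[OF T[unfolded this] \<sigma>]
  show "tm_rel G (sb \<sigma> T') (sb \<sigma>' T') (sb \<sigma> t) (sb \<sigma>' t')"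
    by (rule tm_rel_conv[OF validD[OF t \<sigma>] uT(4,3)])
qed

lemma valid_beta:
  assumes t: "(a, U) # \<Gamma> \<turnstile> t \<^bold>: T" "valid G ((a, U) # \<Gamma>) t t T"
    and u: "ctx_for a \<Gamma> \<turnstile> u \<^bold>: U" "a = Rel \<Longrightarrow> valid G \<Gamma> u u U"
  shows "valid G \<Gamma> (App a (Lam a U t) u) (subst 0 u t) (subst 0 u T)"
proof (rule validI)
  fix \<sigma> \<sigma>' assume \<sigma>: "sub_rel G \<Gamma> \<sigma> \<sigma>'"
  have sub: "sub G \<Gamma> \<sigma>" using sub_rel_sub[OF \<sigma>] by blast
  obtain s where U: "\<Gamma> \<turnstile> U \<^bold>: Sort s" using ctx_wf(2)[OF t(1)] ctx_wf_tail by blast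
  note uu = valid_arg[OF U u(1,1,2) \<sigma>]
  have "sb \<sigma> (App a (Lam a U t) u) = App a (sb \<sigma> (Lam a U t)) (sb \<sigma> u)" by simp
  with tm_rel_expand[OF validD[OF t(2) sub_rel_scons[OF \<sigma> U uu]] beta_sub[OF t(1) sub ctx_for_sub[OF sub u(1)]]]
  show "tm_rel G (sb \<sigma> (subst 0 u T)) (sb \<sigma>' (subst 0 u T)) (sb \<sigma> (App a (Lam a U t) u)) (sb \<sigma>' (subst 0 u t))"
    unfolding sb_subst0 by metis
qed

text \<open>Terms of function type are compared through their applications, and the applied
  eta-expansion reaches the applied original in one head step.\<close>

lemma valid_eta:
  assumes t: "\<Gamma> \<turnstile> t \<^bold>: Fun a s s' U T" "valid G \<Gamma> t t (Fun a s s' U T)"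
  shows "valid G \<Gamma> t (Lam a U (App a (lift 0 t) (Var 0))) (Fun a s s' U T)"
proof (rule validI)
  let ?t = "Lam a U (App a (lift 0 t) (Var 0))"
  fix \<sigma> \<sigma>' assume \<sigma>: "sub_rel G \<Gamma> \<sigma> \<sigma>'"
  have sub: "sub G \<Gamma> \<sigma>'" using sub_rel_sub[OF \<sigma>] by blast
  obtain r where F: "\<Gamma> \<turnstile> Fun a s s' U T \<^bold>: Sort r" using validity(2)[OF t(1)] by blast
  have eqU: "G \<turnstile> sb \<sigma> U \<^bold>= sb \<sigma>' U \<^bold>: Sort s"
    using valid_eq[OF eq_refl[OF typing_Fun_inv(1)[OF F]] \<sigma>] by simp
  note eta = eq_eta[OF t(1)]
  from validD[OF t(2) \<sigma>] have tt: "tm_rel G (Fun a s s' (sb \<sigma> U) (sb (up \<sigma>) T))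
      (Fun a s s' (sb \<sigma>' U) (sb (up \<sigma>') T)) (sb \<sigma> t) (sb \<sigma>' t)" by simp
  obtain k where "univ G k (Fun a s s' (sb \<sigma> U) (sb (up \<sigma>) T)) (Fun a s s' (sb \<sigma>' U) (sb (up \<sigma>') T))"
    using tt by (rule tm_rel_level)
  then have "tm_rel G (Fun a s s' (sb \<sigma> U) (sb (up \<sigma>) T)) (Fun a s s' (sb \<sigma>' U) (sb (up \<sigma>') T))
      (sb \<sigma> t) (sb \<sigma>' ?t)"
  proof (rule tm_rel_FunI)
    show "G \<turnstile> sb \<sigma> t \<^bold>= sb \<sigma>' ?t \<^bold>: Fun a s s' (sb \<sigma> U) (sb (up \<sigma>) T)"
      using valid_eq[OF eta \<sigma>] by simp
    fix u u' assume u: "arg_rel G a (sb \<sigma> U) (sb \<sigma>' U) u u'"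
    have step: "App a (sb \<sigma>' ?t) u' \<leadsto>* App a (sb \<sigma>' t) u'"
      using wbeta[of a "sb \<sigma>' U" "App a (lift 0 (sb \<sigma>' t)) (Var 0)" u'] by (simp add: subst0_sb)
    have "G \<turnstile> sb \<sigma>' t \<^bold>= sb \<sigma>' ?t \<^bold>: Fun a s s' (sb \<sigma>' U) (sb (up \<sigma>') T)"
      using sub_eq[OF eta sub] by simp
    moreover have "arg_eq a G u' u' (sb \<sigma>' U)"
      using arg_rel_typed(2)[OF u eqU] eq_refl by (cases a) (simp_all add: arg_eq_def)
    ultimately have "G \<turnstile> App a (sb \<sigma>' ?t) u' \<^bold>= App a (sb \<sigma>' t) u' \<^bold>: subst 0 u' (sb (up \<sigma>') T)"
      using eq_app eq_sym by blast
    from tm_rel_sym[OF tm_rel_expand[OF tm_rel_sym[OF tm_rel_app[OF tt u]] step this]]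
    show "tm_rel G (subst 0 u (sb (up \<sigma>) T)) (subst 0 u' (sb (up \<sigma>') T)) (App a (sb \<sigma> t) u) (App a (sb \<sigma>' ?t) u')" .
  qed
  then show "tm_rel G (sb \<sigma> (Fun a s s' U T)) (sb \<sigma>' (Fun a s s' U T)) (sb \<sigma> t) (sb \<sigma>' ?t)" by simp
qed

lemma valid_sym:
  assumes "valid G \<Gamma> t t' T" shows "valid G \<Gamma> t' t T"
  using tm_rel_sym validD[OF assms sub_rel_sym] by (intro validI) blast

lemma valid_trans:
  assumes "valid G \<Gamma> t t' T" "valid G \<Gamma> t' t'' T" shows "valid G \<Gamma> t t'' T"
proof (rule validI)
  fix \<sigma> \<sigma>' assume \<sigma>: "sub_rel G \<Gamma> \<sigma> \<sigma>'"
  show "tm_rel G (sb \<sigma> T) (sb \<sigma>' T) (sb \<sigma> t) (sb \<sigma>' t'')"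
    by (rule tm_rel_trans[OF validD[OF assms(1) \<sigma>] validD[OF assms(2) sub_rel_refl_right[OF \<sigma>]]])
qed

text \<open>The semantic rules are phrased for equations, so typing a function type, a lambda or an
  application is the diagonal case of the congruence rule.\<close>

theorem fundamental:
  "\<turnstile> \<Gamma> \<Longrightarrow> True"
  "\<Gamma> \<turnstile> t \<^bold>: T \<Longrightarrow> valid G \<Gamma> t t T"
  "\<Gamma> \<turnstile> t \<^bold>= t' \<^bold>: T \<Longrightarrow> valid G \<Gamma> t t' T"
proof (induction rule: wf_ctx_typing_equality.inducts)
  case (ty_sort \<Gamma> s s')
  then obtain i where s: "s = Set i" "s' = Set (Suc i)" by (auto simp: Axiom_def)
  show ?case
  proof (rule validI)
    fix \<sigma> \<sigma>' assume "sub_rel G \<Gamma> \<sigma> \<sigma>'"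
    then have "\<turnstile> G" using sub_rel_sub by blast
    from tm_rel_SortI[OF univ_Sort[OF this]]
    show "tm_rel G (sb \<sigma> (Sort s')) (sb \<sigma>' (Sort s')) (sb \<sigma> (Sort s)) (sb \<sigma>' (Sort s))"
      unfolding s by simp
  qed
next
  case (ty_pi \<Gamma> U s1 a T s2 s3)
  from valid_Fun[OF eq_refl[OF ty_pi.hyps(1)] ty_pi.IH(1) eq_refl[OF ty_pi.hyps(2)] ty_pi.IH(2) ty_pi.hyps(3)] show ?case .
next
  case (ty_var \<Gamma> i U)
  show ?case using ty_var.hyps by (intro validI) (fastforce simp: sub_rel_def)
next
  case (ty_lam a U \<Gamma> t T s s' s'')
  from valid_Lam[OF eq_refl[OF typing_Fun_inv(1)[OF ty_lam.hyps(2)]] ty_lam.IH(2) eq_refl[OF wf_ctx_typing_equality.ty_lam[OF ty_lam.hyps(1) ty_lam.hyps(2)]]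
      eq_refl[OF ty_lam.hyps(1)] ty_lam.IH(1)] show ?case .
next
  case (ty_app \<Gamma> t a s s' U T u)
  have "a = Rel \<Longrightarrow> valid G \<Gamma> u u U" using ty_app.IH(2) by simp
  from valid_App[OF ty_app.hyps(1) ty_app.IH(1) ty_app.hyps(2) ty_app.hyps(2) this] show ?case .
next
  case (ty_conv \<Gamma> t T T' s)
  from valid_conv[OF ty_conv.IH(1) ty_conv.IH(2)] show ?case .
next
  case (eq_beta a U \<Gamma> t T u)
  have "a = Rel \<Longrightarrow> valid G \<Gamma> u u U" using eq_beta.IH(2) by simp
  from valid_beta[OF eq_beta.hyps(1) eq_beta.IH(1) eq_beta.hyps(2) this] show ?case .
next
  case (eq_eta \<Gamma> t a s s' U T)
  from valid_eta[OF eq_eta] show ?case .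
next
  case (eq_sym \<Gamma> t t' T)
  from valid_sym[OF eq_sym.IH(1)] show ?case .
next
  case (eq_trans \<Gamma> t t' T t'')
  from valid_trans[OF eq_trans.IH(1) eq_trans.IH(2)] show ?case .
next
  case (eq_pi \<Gamma> U U' s1 a T T' s2 s3)
  from valid_Fun[OF eq_pi.hyps(1) eq_pi.IH(1) eq_pi.hyps(2) eq_pi.IH(2) eq_pi.hyps(3)] show ?case .
next
  case (eq_lam \<Gamma> U U' s1 a T s2 t t')
  obtain s3 where s3: "(s1, s2, s3) \<in> Rule" using Rule_ex by blast
  have "\<Gamma> \<turnstile> U \<^bold>: Sort s1" using validity(3)[OF eq_lam.hyps(1)] by blast
  from valid_Fun[OF eq_refl[OF this] valid_left[OF eq_lam.IH(1)] eq_refl[OF eq_lam.hyps(2)] eq_lam.IH(2) s3]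
  have "valid G \<Gamma> (Fun a s1 s2 U T) (Fun a s1 s2 U T) (Sort s3)" .
  from valid_Lam[OF eq_lam.hyps(1) this wf_ctx_typing_equality.eq_lam[OF eq_lam.hyps(1) eq_lam.hyps(2) eq_lam.hyps(3)] eq_lam.hyps(3) eq_lam.IH(3)] show ?case .
next
  case (eq_app_rel \<Gamma> t t' s s' U T u u')
  have "\<Gamma> \<turnstile> t \<^bold>: Fun Rel s s' U T" "ctx_for Rel \<Gamma> \<turnstile> u \<^bold>: U" "ctx_for Rel \<Gamma> \<turnstile> u' \<^bold>: U"
    using validity(3)[OF eq_app_rel.hyps(1)] validity(3)[OF eq_app_rel.hyps(2)] by auto
  from valid_App[OF this(1) eq_app_rel.IH(1) this(2,3) eq_app_rel.IH(2)] show ?case .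
next
  case (eq_app_irr \<Gamma> t t' s s' U T u u')
  have "\<Gamma> \<turnstile> t \<^bold>: Fun Irr s s' U T" using validity(3)[OF eq_app_irr.hyps(1)] by blast
  from valid_App[OF this eq_app_irr.IH(1) eq_app_irr.hyps(2) eq_app_irr.hyps(3)] show ?case by simp
next
  case (eq_conv \<Gamma> t t' T T' s)
  from valid_conv[OF eq_conv.IH(1) eq_conv.IH(2)] show ?case .
qed auto

text \<open>Variables are neutral, so \<open>reflect\<close> relates each to itself once its type is
  semantically valid. That comes from the fundamental theorem at a shorter suffix of
  \<open>G\<close>, so the induction grows the suffix from the empty one; a suffix that drops
  \<open>n\<close> bindings is embedded by shifting indices by \<open>n\<close>.\<close>

lemma sub_rel_id: assumes G: "\<turnstile> G" shows "sub_rel G G Var Var"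
proof -
  have wf: "\<turnstile> drop n G" for n
  proof (induction n)
    case (Suc n)
    then show ?case
      by (cases "drop n G") (auto simp: drop_Suc drop_tl intro: wf_empty dest: ctx_wf_tail(1))
  qed (simp add: G)
  have "sub_rel G (drop n G) (\<lambda>i. Var (i + n)) (\<lambda>i. Var (i + n))" if "n \<le> length G" for n
    using that
  proof (induction n rule: inc_induct)
    case base
    then show ?case using G by (simp add: sub_rel_def sub_def)
  next
    case (step n)
    obtain a U where aU: "G ! n = (a, U)" by (cases "G ! n")
    have drop: "drop n G = (a, U) # drop (Suc n) G" using Cons_nth_drop_Suc[OF step(2)] aU by simp
    let ?\<sigma> = "\<lambda>i. Var (i + Suc n)"
    obtain k where U: "drop (Suc n) G \<turnstile> U \<^bold>: Sort (Set k)"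
      using ctx_wf_tail(2) wf[of n] unfolding drop by (metis srt.exhaust)
    obtain R where R: "LR G (univ G) k (sb ?\<sigma> U) (sb ?\<sigma> U) R"
      using valid_type[OF fundamental(2)[OF U] step.IH] by (rule univE)
    have n: "ctx_for a G \<turnstile> Var n \<^bold>: sb ?\<sigma> U"
      using sub_Var[OF G] step(2) aU sb_lifts[of Var "Suc n" U] by (fastforce simp: sub_def)
    have "arg_rel G a (sb ?\<sigma> U) (sb ?\<sigma> U) (Var n) (Var n)"
    proof (cases a)
      case Rel
      from n have "G \<turnstile> Var n \<^bold>= Var n \<^bold>: sb ?\<sigma> U" using eq_refl Rel by simp
      then have "R (Var n) (Var n)" by (intro reflect[OF R]) simp_all
      with R show ?thesis unfolding arg_rel_def tm_rel_def Rel by auto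
    next
      case Irr
      with n show ?thesis by (simp add: arg_rel_def)
    qed
    from sub_rel_scons[OF step.IH U this] have "sub_rel G (drop n G) (Var n \<cdot> ?\<sigma>) (Var n \<cdot> ?\<sigma>)"
      unfolding drop .
    moreover have "Var n \<cdot> ?\<sigma> = (\<lambda>i. Var (i + n))"
      by (rule ext) (auto simp: scons_def split: nat.split)
    ultimately show ?case by simp
  qed
  from this[of 0] show ?thesis by simp
qed

theorem theorem5p7:
  fixes \<Gamma> :: ctx and a :: annot and s1 s2 s1' s2' s3 :: srt and U T U' T' :: tm
  assumes "\<Gamma> \<turnstile> Fun a s1 s2 U T \<^bold>= Fun a s1' s2' U' T' \<^bold>: Sort s3"
  shows "s1 = s1' \<and> s2 = s2' \<and> (\<Gamma> \<turnstile> U \<^bold>= U' \<^bold>: Sort s1) \<and> ((a, U) # \<Gamma> \<turnstile> T \<^bold>= T' \<^bold>: Sort s2)"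
proof -
  obtain k where "s3 = Set k" by (cases s3)
  \<comment> \<open>The target of evaluation is \<open>\<Gamma>\<close> itself, so the identity
    substitution returns the given types unchanged.\<close>
  with assms have "valid \<Gamma> \<Gamma> (Fun a s1 s2 U T) (Fun a s1' s2' U' T') (Sort (Set k))"
    using fundamental(3) by blast
  from valid_type[OF this sub_rel_id[OF ctx_wf(3)[OF assms]]]
  have "univ \<Gamma> k (Fun a s1 s2 U T) (Fun a s1' s2' U' T')" by simp
  then show ?thesis by (rule univ_FunD) (use univ_eq in simp)
qed

end
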